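(* Let $\mathfrak a$ be an idempotent ideal of $\mathbb{S}_n$ with $\mathfrak a\ne\mathbb{S}_n$. Then: (1) $\mathfrak a$ is a product $\mathfrak q_1\cdots\mathfrak q_s$ of pairwise incomparable idempotent prime ideals, and such a product is unique: if $\mathfrak a=\mathfrak q_1\cdots\mathfrak q_s=\mathfrak r_1\cdots\mathfrak r_t$ are two such products, then $s=t$ and $\mathfrak q_i=\mathfrak r_{\sigma(i)}$ for some permutation $\sigma$. (2) $\mathfrak a$ is an intersection $\mathfrak q_1\cap\cdots\cap\mathfrak q_s$ of pairwise incomparable idempotent prime ideals, unique in the same sense. (3) The sets of primes in (1) and (2) coincide, so $\mathfrak a=\mathfrak q_1\cdots\mathfrak q_s=\mathfrak q_1\cap\cdots\cap\mathfrak q_s$. (4) $\{\mathfrak q_1,\dots,\mathfrak q_s\}=\mathrm{Min}(\mathfrak a)$, the set of minimal primes over $\mathfrak a$. Hence $\mathfrak a=\prod_{\mathfrak p\in\mathrm{Min}(\mathfrak a)}\mathfrak p=\bigcap_{\mathfrak p\in\mathrm{Min}(\mathfrak a)}\mathfrak p$, and every minimal prime over $\mathfrak a$ is idempotent.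
   Context: $K$ is a field. $\mathbb{S}_n$ is the $K$-algebra generated by $x_1,\dots,x_n,y_1,\dots,y_n$ subject to the defining relations $y_ix_i=1$ for all $i$, and $[x_i,y_j]=[x_i,x_j]=[y_i,y_j]=0$ for all $i\ne j$. An ideal $I$ is idempotent if $I^2=I$. Two ideals are incomparable if neither contains the other. $\mathrm{Min}(\mathfrak a)$ denotes the set of prime ideals minimal among those containing $\mathfrak a$. *)

theory Defs
  imports "HOL-Combinatorics.Permutations" "HOL-Algebra.Ideal_Product"
begin

text \<open>The Jacobson algebra S_n over a field K. Since y_i x_i = 1 and all generators
  with different indices commute, S_n is the tensor product of n copies of
  S_1 = K<x,y>/(yx = 1), i.e. the monoid algebra over K of the n-th power of the
  bicyclic monoid. A K-basis is given by the monomials x^a y^b with a, b in N^n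
  (exponent vectors supported on indices below n), and
  (x^a y^b)(x^c y^d) = x^(a + (c - b)) y^((b - c) + d) with truncated subtraction,
  computed coordinatewise.\<close>

type_synonym mon = "(nat \<Rightarrow> nat) \<times> (nat \<Rightarrow> nat)"

definition valid_mon :: "nat \<Rightarrow> mon \<Rightarrow> bool" where
  "valid_mon n m \<longleftrightarrow> (\<forall>i. n \<le> i \<longrightarrow> fst m i = 0 \<and> snd m i = 0)"

definition mon_mult :: "mon \<Rightarrow> mon \<Rightarrow> mon" where
  "mon_mult u v = ((\<lambda>i. fst u i + (fst v i - snd u i)), (\<lambda>i. (snd u i - fst v i) + snd v i))"

definition mon_one :: mon where
  "mon_one = ((\<lambda>_. 0), (\<lambda>_. 0))"

definition S_carrier :: "nat \<Rightarrow> (mon \<Rightarrow> 'k::field) set" where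
  "S_carrier n = {f. finite {m. f m \<noteq> 0} \<and> (\<forall>m. f m \<noteq> 0 \<longrightarrow> valid_mon n m)}"

definition S_mult :: "(mon \<Rightarrow> 'k::field) \<Rightarrow> (mon \<Rightarrow> 'k) \<Rightarrow> (mon \<Rightarrow> 'k)" where
  "S_mult f g = (\<lambda>m. \<Sum>(u, v) \<in> {(u, v). f u \<noteq> 0 \<and> g v \<noteq> 0 \<and> mon_mult u v = m}. f u * g v)"

definition S :: "nat \<Rightarrow> (mon \<Rightarrow> 'k::field) ring" where
  "S n = \<lparr> carrier = S_carrier n,
           mult = S_mult,
           one = (\<lambda>m. if m = mon_one then 1 else 0),
           zero = (\<lambda>_. 0),
           add = (\<lambda>f g m. f m + g m) \<rparr>"

definition gen_x :: "nat \<Rightarrow> (mon \<Rightarrow> 'k::field)" where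
  "gen_x i = (\<lambda>m. if m = ((\<lambda>j. if j = i then 1 else 0), (\<lambda>_. 0)) then 1 else 0)"
definition gen_y :: "nat \<Rightarrow> (mon \<Rightarrow> 'k::field)" where
  "gen_y i = (\<lambda>m. if m = ((\<lambda>_. 0), (\<lambda>j. if j = i then 1 else 0)) then 1 else 0)"

definition idempotent_ideal :: "('a, 'b) ring_scheme \<Rightarrow> 'a set \<Rightarrow> bool" where
  "idempotent_ideal R I \<longleftrightarrow> ideal I R \<and> ideal_prod R I I = I"

definition prime_ideal :: "('a, 'b) ring_scheme \<Rightarrow> 'a set \<Rightarrow> bool" where
  "prime_ideal R P \<longleftrightarrow> ideal P R \<and> P \<noteq> carrier R \<and>
     (\<forall>I J. ideal I R \<longrightarrow> ideal J R \<longrightarrow> ideal_prod R I J \<subseteq> P \<longrightarrow> I \<subseteq> P \<or> J \<subseteq> P)"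

definition min_primes :: "('a, 'b) ring_scheme \<Rightarrow> 'a set \<Rightarrow> 'a set set" where
  "min_primes R A = {P. prime_ideal R P \<and> A \<subseteq> P \<and>
     (\<forall>Q. prime_ideal R Q \<longrightarrow> A \<subseteq> Q \<longrightarrow> Q \<subseteq> P \<longrightarrow> Q = P)}"

fun ideal_prod_list :: "('a, 'b) ring_scheme \<Rightarrow> 'a set list \<Rightarrow> 'a set" where
  "ideal_prod_list R [] = carrier R"
| "ideal_prod_list R [I] = I"
| "ideal_prod_list R (I # Is) = ideal_prod R I (ideal_prod_list R Is)"

definition ideal_inter_list :: "('a, 'b) ring_scheme \<Rightarrow> 'a set list \<Rightarrow> 'a set" where
  "ideal_inter_list R Is = carrier R \<inter> \<Inter>(set Is)"

definition incomp_idem_primes :: "('a, 'b) ring_scheme \<Rightarrow> 'a set list \<Rightarrow> bool" where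
  "incomp_idem_primes R qs \<longleftrightarrow>
     (\<forall>q \<in> set qs. prime_ideal R q \<and> idempotent_ideal R q) \<and>
     (\<forall>i < length qs. \<forall>j < length qs. i \<noteq> j \<longrightarrow> \<not> qs ! i \<subseteq> qs ! j)"

definition same_up_to_perm :: "'a list \<Rightarrow> 'a list \<Rightarrow> bool" where
  "same_up_to_perm qs rs \<longleftrightarrow> length qs = length rs \<and>
     (\<exists>\<sigma>. \<sigma> permutes {..<length qs} \<and> (\<forall>i < length qs. qs ! i = rs ! \<sigma> i))"

end

theory Submission
  imports Defs "HOL-Library.Poly_Mapping"
begin

text \<open>An idempotent ideal \<open>a\<close> is stable under all divided powers of the derivations attached to the
  degrees \<open>deg x\<^sub>i = 1\<close>, \<open>deg y\<^sub>i = -1\<close>: a divided power of order \<open>k\<close> applied to a product of \<open>k + 1\<close>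
  elements of \<open>a\<close> leaves one factor untouched in each term. Hence \<open>a\<close> is \<open>\<int>\<^sup>n\<close>-graded. Given a
  homogeneous \<open>f\<close> outside \<open>P\<^sub>J = \<Sum>\<^sub>j\<^sub>\<in>\<^sub>J \<pp>\<^sub>j\<close>, the ideal generated by \<open>f\<close> contains the idempotent
  \<open>e\<^sub>I = \<Prod>\<^sub>i\<^sub>\<in>\<^sub>I (1 - x\<^sub>i y\<^sub>i)\<close>, where \<open>I\<close> is the complement of \<open>J\<close>. So \<open>e\<^sub>I \<notin> a\<close> forces \<open>a \<subseteq> P\<^sub>J\<close>, and
  expanding \<open>1\<close> coordinatewise shows conversely that every \<open>f \<notin> a\<close> lies outside some such \<open>P\<^sub>J\<close>:
  \<open>a\<close> is the intersection of the \<open>P\<^sub>J\<close> containing it. These are prime (by a leading term argument,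
  primality may be tested on homogeneous elements) and have local left units, so their products are
  intersections, and the usual comparison of prime factors identifies the factors with the minimal primes.\<close>

section \<open>The Jacobson algebra as a monoid algebra\<close>

text \<open>A copy of \<open>mon\<close>, written additively, so that \<open>Poly_Mapping\<close> supplies the
  (noncommutative) monoid algebra as a type of class \<open>ring_1\<close>.\<close>

datatype bic = Bic (xe: "nat \<Rightarrow> nat") (ye: "nat \<Rightarrow> nat")

instantiation bic :: monoid_add
begin

definition zero_bic where "0 = Bic (\<lambda>_. 0) (\<lambda>_. 0)"

definition plus_bic where
  "u + v = Bic (\<lambda>i. xe u i + (xe v i - ye u i)) (\<lambda>i. (ye u i - xe v i) + ye v i)"

instance
  by standard (auto simp: zero_bic_def plus_bic_def bic.expand fun_eq_iff)

end

lemma xe_zero [simp]: "xe 0 i = 0" and ye_zero [simp]: "ye 0 i = 0"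
  by (simp_all add: zero_bic_def)

lemma xe_plus [simp]: "xe (u + v) i = xe u i + (xe v i - ye u i)"
  and ye_plus [simp]: "ye (u + v) i = (ye u i - xe v i) + ye v i"
  by (simp_all add: plus_bic_def)

lemma bic_eqI: "(\<And>i. xe u i = xe v i) \<Longrightarrow> (\<And>i. ye u i = ye v i) \<Longrightarrow> u = v"
  by (cases u; cases v) auto

definition wt :: "nat \<Rightarrow> bic \<Rightarrow> int" where
  "wt i u = int (xe u i) - int (ye u i)"

text \<open>Truncated differences satisfy (c - b) - (b - c) = c - b over the integers, so
  cancellation of y against x leaves the degree additive.\<close>

lemma wt_plus [simp]: "wt i (u + v) = wt i u + wt i v"
  by (simp add: wt_def)

abbreviation lookup where "lookup \<equiv> Poly_Mapping.lookup"
abbreviation keys where "keys \<equiv> Poly_Mapping.keys"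
abbreviation single where "single \<equiv> Poly_Mapping.single"
abbreviation bmon :: "bic \<Rightarrow> bic \<Rightarrow>\<^sub>0 'k::field" where "bmon u \<equiv> single u 1"

definition additive_closed :: "'a::comm_monoid_add set \<Rightarrow> bool" where
  "additive_closed Q \<longleftrightarrow> 0 \<in> Q \<and> (\<forall>x\<in>Q. \<forall>y\<in>Q. x + y \<in> Q)"

lemma additive_closed_sum:
  assumes "additive_closed Q" "\<And>i. i \<in> I \<Longrightarrow> f i \<in> Q"
  shows "sum f I \<in> Q"
  using assms(2) assms(1) by (induction I rule: infinite_finite_induct) (auto simp: additive_closed_def)

lemma sum_single_keys: "(\<Sum>u\<in>keys p. single u (lookup p u)) = p"
proof (rule poly_mapping_eqI)
  fix k
  show "lookup (\<Sum>u\<in>keys p. single u (lookup p u)) k = lookup p k"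
    by (simp add: lookup_sum lookup_single when_def in_keys_iff)
qed

text \<open>Reduction of an additive property to the monomials of one fixed \<open>p\<close>, so
  that facts about its support stay available.\<close>

lemma poly_single_induct:
  assumes "additive_closed {p. P p}" "\<And>u. u \<in> keys p \<Longrightarrow> P (single u (lookup p u))"
  shows "P p"
  using additive_closed_sum[OF assms(1), of "keys p" "\<lambda>u. single u (lookup p u)"] assms(2)
  by (simp add: sum_single_keys)

definition bic_alg :: "nat \<Rightarrow> (bic \<Rightarrow>\<^sub>0 'k::field) set" where
  "bic_alg n = {p. \<forall>u\<in>keys p. \<forall>i\<ge>n. xe u i = 0 \<and> ye u i = 0}"

lemma bic_alg_zero [simp]: "0 \<in> bic_alg n"
  and bic_alg_one [simp]: "1 \<in> bic_alg n"
  by (simp_all add: bic_alg_def)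

lemma bic_alg_add [simp]: "p \<in> bic_alg n \<Longrightarrow> q \<in> bic_alg n \<Longrightarrow> p + q \<in> bic_alg n"
  using keys_add[of p q] unfolding bic_alg_def by blast

lemma bic_alg_uminus [simp]: "p \<in> bic_alg n \<Longrightarrow> - p \<in> bic_alg n"
  by (simp add: bic_alg_def in_keys_iff)

lemma bic_alg_diff [simp]: "p \<in> bic_alg n \<Longrightarrow> q \<in> bic_alg n \<Longrightarrow> p - q \<in> bic_alg n"
  using bic_alg_add[of p n "- q"] by simp

lemma bic_alg_mult [simp]: "p \<in> bic_alg n \<Longrightarrow> q \<in> bic_alg n \<Longrightarrow> p * q \<in> bic_alg n"
  using keys_mult[of p q] unfolding bic_alg_def by fastforce

lemma bic_alg_single [simp]: "(\<And>i. i \<ge> n \<Longrightarrow> xe u i = 0 \<and> ye u i = 0) \<Longrightarrow> single u c \<in> bic_alg n"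
  by (auto simp: bic_alg_def split: if_splits)

section \<open>Diagonal operators and homogeneous components\<close>

definition scale :: "(bic \<Rightarrow> 'k) \<Rightarrow> (bic \<Rightarrow>\<^sub>0 'k) \<Rightarrow> (bic \<Rightarrow>\<^sub>0 'k::field)" where
  "scale \<beta> p = Poly_Mapping.mapp (\<lambda>u c. \<beta> u * c) p"

lemma lookup_scale [simp]: "lookup (scale \<beta> p) u = \<beta> u * lookup p u"
  by (simp add: scale_def lookup_mapp when_def in_keys_iff)

lemma keys_scale: "keys (scale \<beta> p) = {u \<in> keys p. \<beta> u \<noteq> 0}"
  by (auto simp: in_keys_iff)

lemma scale_bic_alg [simp]: "p \<in> bic_alg n \<Longrightarrow> scale \<beta> p \<in> bic_alg n"
  by (auto simp: bic_alg_def keys_scale)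

lemma scale_cong: "(\<And>u. u \<in> keys p \<Longrightarrow> \<beta> u = \<gamma> u) \<Longrightarrow> scale \<beta> p = scale \<gamma> p"
  by (rule poly_mapping_eqI) (auto simp: in_keys_iff)

lemma scale_add [simp]: "scale \<beta> (p + q) = scale \<beta> p + scale \<beta> q"
  by (rule poly_mapping_eqI) (simp add: lookup_add algebra_simps)

lemma scale_zero [simp]: "scale \<beta> 0 = 0"
  by (rule poly_mapping_eqI) simp

lemma scale_zero_fun [simp]: "scale (\<lambda>_. 0) p = 0"
  by (rule poly_mapping_eqI) simp

lemma scale_diff_fun: "scale (\<lambda>u. \<beta> u - \<gamma> u) p = scale \<beta> p - scale \<gamma> p"
  by (rule poly_mapping_eqI) (simp add: lookup_minus algebra_simps)

lemma scale_single [simp]: "scale \<beta> (single u c) = single u (\<beta> u * c)"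
  by (rule poly_mapping_eqI) (auto simp: lookup_single when_def)

text \<open>Distinct \<open>u\<close> may share the product \<open>u + v\<close>, but
  \<open>\<beta>\<close> is evaluated at that product, so the rule holds monomial by
  monomial.\<close>

lemma scale_mult_single:
  "scale \<beta> (p * single v c) = scale (\<lambda>u. \<beta> (u + v)) p * single v c"
proof (rule poly_single_induct[where p = p])
  show "additive_closed {p. scale \<beta> (p * single v c) = scale (\<lambda>u. \<beta> (u + v)) p * single v c}"
    by (auto simp: additive_closed_def distrib_right)
qed (simp add: mult_single mult.assoc)

lemma scale_single_mult:
  "scale \<beta> (single v c * p) = single v c * scale (\<lambda>u. \<beta> (v + u)) p"
proof (rule poly_single_induct[where p = p])
  show "additive_closed {p. scale \<beta> (single v c * p) = single v c * scale (\<lambda>u. \<beta> (v + u)) p}"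
    by (auto simp: additive_closed_def distrib_left)
qed (simp add: mult_single mult.left_commute)

definition part :: "(bic \<Rightarrow> bool) \<Rightarrow> (bic \<Rightarrow>\<^sub>0 'k) \<Rightarrow> (bic \<Rightarrow>\<^sub>0 'k::field)" where
  "part C = scale (\<lambda>u. if C u then 1 else 0)"

lemma part_bic_alg [simp]: "p \<in> bic_alg n \<Longrightarrow> part C p \<in> bic_alg n"
  by (simp add: part_def)

lemma part_add [simp]: "part C (p + q) = part C p + part C q"
  by (simp add: part_def)

lemma lookup_part: "lookup (part C p) u = (if C u then lookup p u else 0)"
  by (simp add: part_def)

lemma keys_part: "keys (part C p) = {u \<in> keys p. C u}"
  by (auto simp: in_keys_iff lookup_part split: if_splits)

lemma part_all: "(\<And>u. u \<in> keys p \<Longrightarrow> C u) \<Longrightarrow> part C p = p"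
  by (rule poly_mapping_eqI) (auto simp: lookup_part in_keys_iff)

lemma part_none: "(\<And>u. u \<in> keys p \<Longrightarrow> \<not> C u) \<Longrightarrow> part C p = 0"
  by (rule poly_mapping_eqI) (auto simp: lookup_part in_keys_iff)

lemma part_in_additive_closed:
  assumes Q: "additive_closed Q" and comp: "\<And>d. d \<in> D \<Longrightarrow> part (\<lambda>u. w u = d) p \<in> Q"
  shows "part (\<lambda>u. w u \<in> D) p \<in> Q"
proof -
  \<comment> \<open>\<open>D\<close> may be infinite; only values of \<open>w\<close> on the support
    contribute, which leaves a finite sum.\<close>
  have "part (\<lambda>u. w u \<in> D) p = (\<Sum>d\<in>D \<inter> w ` keys p. part (\<lambda>u. w u = d) p)"
  proof (rule poly_mapping_eqI)
    fix u
    have "(\<Sum>d\<in>D \<inter> w ` keys p. lookup (part (\<lambda>u. w u = d) p) u)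
        = (\<Sum>d\<in>D \<inter> w ` keys p. if d = w u then lookup p u else 0)"
      by (rule sum.cong) (auto simp: lookup_part)
    also have "\<dots> = (if w u \<in> D then lookup p u else 0)"
      by (auto simp: sum.delta in_keys_iff)
    finally show "lookup (part (\<lambda>u. w u \<in> D) p) u
        = lookup (\<Sum>d\<in>D \<inter> w ` keys p. part (\<lambda>u. w u = d) p) u"
      by (simp add: lookup_sum lookup_part)
  qed
  then show ?thesis
    using additive_closed_sum[OF Q] comp by (metis (no_types, lifting) Int_iff)
qed

lemma ex_part_notin:
  assumes "additive_closed Q" "p \<notin> Q"
  obtains d where "part (\<lambda>u. w u = d) p \<notin> Q"
  using part_in_additive_closed[OF assms(1), of UNIV w p] assms(2) part_all[of p "\<lambda>_. True"]
  by auto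

section \<open>The primes generated by elements \<open>1 - x\<^sub>j y\<^sub>j\<close>\<close>

definition ypow :: "nat set \<Rightarrow> nat \<Rightarrow> bic" where
  "ypow J N = Bic (\<lambda>_. 0) (\<lambda>i. if i \<in> J then N else 0)"

definition xpow :: "nat set \<Rightarrow> nat \<Rightarrow> bic" where
  "xpow J N = Bic (\<lambda>i. if i \<in> J then N else 0) (\<lambda>_. 0)"

lemma xe_ypow [simp]: "xe (ypow J N) i = 0"
  and ye_ypow [simp]: "ye (ypow J N) i = (if i \<in> J then N else 0)"
  and xe_xpow [simp]: "xe (xpow J N) i = (if i \<in> J then N else 0)"
  and ye_xpow [simp]: "ye (xpow J N) i = 0"
  by (simp_all add: ypow_def xpow_def)

lemma ypow_xpow: "ypow J N + xpow J N = 0"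
  by (rule bic_eqI) auto

lemma ypow_add: "ypow J M + ypow J N = ypow J (M + N)"
  by (rule bic_eqI) auto

text \<open>Two-sided ideals of the subring \<open>bic_alg n\<close>; negatives come from
  multiplying by -1.\<close>

definition two_sided :: "nat \<Rightarrow> (bic \<Rightarrow>\<^sub>0 'k::field) set \<Rightarrow> bool" where
  "two_sided n A \<longleftrightarrow> A \<subseteq> bic_alg n \<and> additive_closed A \<and>
     (\<forall>r\<in>bic_alg n. \<forall>x\<in>A. r * x \<in> A \<and> x * r \<in> A)"

lemma two_sidedD:
  assumes "two_sided n A"
  shows "x \<in> A \<Longrightarrow> x \<in> bic_alg n"
    and "0 \<in> A"
    and "x \<in> A \<Longrightarrow> y \<in> A \<Longrightarrow> x + y \<in> A"
    and "r \<in> bic_alg n \<Longrightarrow> x \<in> A \<Longrightarrow> r * x \<in> A"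
    and "r \<in> bic_alg n \<Longrightarrow> x \<in> A \<Longrightarrow> x * r \<in> A"
    and "additive_closed A"
  using assms by (auto simp: two_sided_def additive_closed_def)

lemma two_sided_diff:
  assumes "two_sided n A" "x \<in> A" "y \<in> A"
  shows "x - y \<in> A"
  using two_sidedD(3)[OF assms(1,2), of "- y"] two_sidedD(4)[OF assms(1) _ assms(3), of "- 1"] by simp

text \<open>The prime \<open>\<Sum>\<^sub>j\<^sub>\<in>\<^sub>J \<pp>\<^sub>j\<close>, where \<open>\<pp>\<^sub>j\<close> is generated by \<open>1 - x\<^sub>j y\<^sub>j\<close>, described without
  generators: its elements are those killed on the left by a power of \<open>\<Prod>\<^sub>j\<^sub>\<in>\<^sub>J y\<^sub>j\<close>.\<close>

definition std_prime :: "nat \<Rightarrow> nat set \<Rightarrow> (bic \<Rightarrow>\<^sub>0 'k::field) set" where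
  "std_prime n J = {p \<in> bic_alg n. \<exists>N. bmon (ypow J N) * p = 0}"

lemma ypow_kill_mono:
  assumes "bmon (ypow J N) * p = 0" "N \<le> M"
  shows "bmon (ypow J M) * p = 0"
proof -
  have "bmon (ypow J M) * p = bmon (ypow J (M - N)) * (bmon (ypow J N) * p)"
    using assms(2) by (simp add: mult_single ypow_add flip: mult.assoc)
  then show ?thesis
    using assms(1) by simp
qed

text \<open>Annihilation persists for larger exponents, so finitely many conditions can share one
  \<open>N\<close>.\<close>

lemma std_prime_eventually:
  assumes "p \<in> std_prime n J"
  shows "eventually (\<lambda>N. bmon (ypow J N) * p = 0) sequentially"
  using assms ypow_kill_mono unfolding std_prime_def eventually_sequentially by blast

lemma additive_closed_std_prime: "additive_closed (std_prime n J)"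
  unfolding additive_closed_def
proof safe
  fix p q :: "bic \<Rightarrow>\<^sub>0 'k::field"
  assume pq: "p \<in> std_prime n J" "q \<in> std_prime n J"
  then have "eventually (\<lambda>N. bmon (ypow J N) * p = 0 \<and> bmon (ypow J N) * q = 0) sequentially"
    by (intro eventually_conj std_prime_eventually)
  then obtain N where "bmon (ypow J N) * p = 0 \<and> bmon (ypow J N) * q = 0"
    unfolding eventually_sequentially by blast
  then show "p + q \<in> std_prime n J"
    using pq by (auto simp: std_prime_def distrib_left intro!: exI[of _ N])
qed (simp add: std_prime_def)

text \<open>A high enough power of the y's absorbs the x's of \<open>u\<close> and still leaves y^N
  at the right end, next to \<open>p\<close>.\<close>

lemma std_prime_single_mult:
  assumes J: "J \<subseteq> {..<n}" and p: "p \<in> std_prime n J" and u: "single u c \<in> bic_alg n"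
  shows "single u c * p \<in> std_prime n J"
proof -
  obtain N where N: "bmon (ypow J N) * p = 0"
    using p by (auto simp: std_prime_def)
  \<comment> \<open>For each \<open>i\<close> in \<open>J\<close>, cancelling the x's of
    \<open>u\<close> leaves at least \<open>N\<close> factors y_i.\<close>
  define M where "M = N + (\<Sum>i\<in>J. xe u i)"
  have fin: "finite J"
    using J finite_subset by blast
  have M: "N + xe u i \<le> M" if "i \<in> J" for i
    unfolding M_def using member_le_sum[OF that, of "xe u"] fin by simp
  define v where "v = Bic (\<lambda>i. if i \<in> J then 0 else xe u i)
    (\<lambda>i. if i \<in> J then M - xe u i - N + ye u i else ye u i)"
  have "ypow J M + u = v + ypow J N"
    by (rule bic_eqI) (use M in \<open>force simp: v_def\<close>)+
  then have "bmon (ypow J M) * (single u c * p) = single v c * (bmon (ypow J N) * p)"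
    by (simp add: mult_single flip: mult.assoc)
  then show ?thesis
    using N p u by (auto simp: std_prime_def intro!: exI[of _ M])
qed

lemma bic_alg_single_keys: "p \<in> bic_alg n \<Longrightarrow> u \<in> keys p \<Longrightarrow> single u c \<in> bic_alg n"
  by (auto simp: bic_alg_def split: if_splits)

lemma two_sided_std_prime:
  assumes J: "J \<subseteq> {..<n}"
  shows "two_sided n (std_prime n J)"
  unfolding two_sided_def
proof (intro conjI ballI)
  fix r p :: "bic \<Rightarrow>\<^sub>0 'k::field"
  assume r: "r \<in> bic_alg n" and p: "p \<in> std_prime n J"
  show "r * p \<in> std_prime n J"
  proof (rule poly_single_induct[where p = r])
    show "additive_closed {r. r * p \<in> std_prime n J}"
      using additive_closed_std_prime[of n J]
      by (auto simp: additive_closed_def distrib_right)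
    show "single u (lookup r u) * p \<in> std_prime n J" if "u \<in> keys r" for u
      using std_prime_single_mult[OF J p] bic_alg_single_keys[OF r that] by blast
  qed
  show "p * r \<in> std_prime n J"
  proof -
    obtain N where "bmon (ypow J N) * p = 0"
      using p by (auto simp: std_prime_def)
    then have "bmon (ypow J N) * (p * r) = 0"
      by (simp flip: mult.assoc)
    then show ?thesis
      using p r by (auto simp: std_prime_def)
  qed
qed (auto simp: std_prime_def additive_closed_std_prime[unfolded std_prime_def])

lemma one_notin_std_prime: "1 \<notin> std_prime n J"
  by (simp add: std_prime_def) (metis lookup_single_eq lookup_zero zero_neq_one)

text \<open>Left multiplication by a monomial shifts all degrees by a constant, so it kills
  \<open>p\<close> only by killing each component.\<close>

lemma std_prime_part:
  assumes "p \<in> std_prime n J"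
  shows "part (\<lambda>u. wt i u = d) p \<in> std_prime n J"
proof -
  obtain N where "bmon (ypow J N) * p = 0"
    using assms by (auto simp: std_prime_def)
  then have "bmon (ypow J N) * part (\<lambda>u. wt i u = d) p = 0"
    using scale_single_mult[of "\<lambda>u. if wt i u = wt i (ypow J N) + d then 1 else 0" "ypow J N" 1 p]
    by (simp add: part_def)
  then show ?thesis
    using assms by (auto simp: std_prime_def)
qed

section \<open>Idempotents attached to sets of coordinates\<close>

definition std_unit :: "nat set \<Rightarrow> nat \<Rightarrow> bic \<Rightarrow>\<^sub>0 'k::field" where
  "std_unit J N = 1 - bmon (xpow J N) * bmon (ypow J N)"

lemma std_unit_in_std_prime:
  assumes "J \<subseteq> {..<n}"
  shows "(std_unit J N :: bic \<Rightarrow>\<^sub>0 'k::field) \<in> std_prime n J"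
proof -
  have "bmon (ypow J N) * (bmon (xpow J N) * bmon (ypow J N)) = (bmon (ypow J N) :: bic \<Rightarrow>\<^sub>0 'k)"
    by (simp add: mult_single ypow_xpow flip: mult.assoc add.assoc)
  then have "bmon (ypow J N) * (std_unit J N :: bic \<Rightarrow>\<^sub>0 'k) = 0"
    by (simp add: std_unit_def right_diff_distrib)
  moreover have "(std_unit J N :: bic \<Rightarrow>\<^sub>0 'k) \<in> bic_alg n"
    unfolding std_unit_def using assms
    by (intro bic_alg_diff bic_alg_mult bic_alg_one bic_alg_single) auto
  ultimately show ?thesis
    by (auto simp: std_prime_def)
qed

text \<open>Subtracting x^N y^N from 1 changes nothing on elements killed by y^N. This left unit
  lies in the prime itself, which later turns products into intersections.\<close>

lemma std_prime_left_unit: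
  assumes "p \<in> std_prime n J"
  obtains N where "std_unit J N * p = p"
proof -
  obtain N where "bmon (ypow J N) * p = 0"
    using assms by (auto simp: std_prime_def)
  then have "std_unit J N * p = p"
    by (simp add: std_unit_def left_diff_distrib mult.assoc)
  then show ?thesis
    by (rule that)
qed

text \<open>The idempotent \<open>e\<^sub>I\<close> restricted to coordinates below
  \<open>m\<close>; the recursion supports arguments that treat one coordinate at a time.\<close>

primrec corner :: "nat set \<Rightarrow> nat \<Rightarrow> bic \<Rightarrow>\<^sub>0 'k::field" where
  "corner I 0 = 1"
| "corner I (Suc m) = (if m \<in> I then corner I m * std_unit {m} 1 else corner I m)"

lemma corner_cong: "(\<And>i. i < m \<Longrightarrow> i \<in> I \<longleftrightarrow> i \<in> I') \<Longrightarrow> corner I m = corner I' m"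
  by (induction m) auto

lemma std_unit_bic_alg [simp]: "m < n \<Longrightarrow> std_unit {m} N \<in> bic_alg n"
  using std_unit_in_std_prime[of "{m}" n] by (auto simp: std_prime_def)

lemma corner_bic_alg [simp]: "m \<le> n \<Longrightarrow> corner I m \<in> bic_alg n"
  by (induction m) auto

lemma std_unit_commute:
  assumes "xe v m = 0" "ye v m = 0"
  shows "std_unit {m} N * single v c = single v c * std_unit {m} N"
proof -
  have "xpow {m} N + ypow {m} N + v = v + (xpow {m} N + ypow {m} N)"
    by (rule bic_eqI) (use assms in auto)
  then show ?thesis
    by (simp add: std_unit_def algebra_simps mult_single)
qed

lemma corner_commute:
  assumes "\<And>i. i \<in> I \<Longrightarrow> i < m \<Longrightarrow> xe v i = 0 \<and> ye v i = 0"
  shows "corner I m * single v c = single v c * corner I m"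
  using assms
proof (induction m)
  case (Suc m)
  then show ?case
    by (auto simp: mult.assoc std_unit_commute) (simp flip: mult.assoc)
qed simp

text \<open>(1 - x y) x = x - x (y x) = 0, and the factors for other coordinates commute with
  x_i.\<close>

lemma corner_kill_xpow:
  assumes "i \<in> I" "i < m"
  shows "corner I m * bmon (xpow {i} 1) = (0 :: bic \<Rightarrow>\<^sub>0 'k::field)"
  using assms
proof (induction m)
  case (Suc m)
  show ?case
  proof (cases "i = m")
    case True
    have "xpow {m} 1 + ypow {m} 1 + xpow {m} 1 = xpow {m} 1"
      by (simp add: add.assoc ypow_xpow)
    then have "std_unit {m} 1 * bmon (xpow {m} 1) = (0 :: bic \<Rightarrow>\<^sub>0 'k)"
      by (simp add: std_unit_def left_diff_distrib mult_single)
    then show ?thesis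
      using Suc.prems True by (simp add: mult.assoc)
  next
    case False
    then show ?thesis
      using Suc by (auto simp: mult.assoc std_unit_commute) (simp flip: mult.assoc)
  qed
qed simp

text \<open>In normal form the x's stand on the left, so a factor x_i can be split off and meets the
  corner.\<close>

lemma corner_kill:
  fixes c :: "'k::field"
  assumes "i \<in> I" "i < m" "xe w i > 0"
  shows "corner I m * single w c = 0"
proof -
  have "w = xpow {i} 1 + Bic (\<lambda>j. if j = i then xe w i - 1 else xe w j) (ye w)"
    by (rule bic_eqI) (use assms in auto)
  then have "single w c = bmon (xpow {i} 1) * single (Bic (\<lambda>j. if j = i then xe w i - 1 else xe w j) (ye w)) c"
    by (simp add: mult_single)
  then show ?thesis
    using corner_kill_xpow[OF assms(1,2), where 'k = 'k] by (simp flip: mult.assoc)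
qed

lemma lookup_mult_single_zero:
  assumes "ye v i > 0"
  shows "lookup (p * single v c) 0 = 0"
proof (rule ccontr)
  assume "lookup (p * single v c) 0 \<noteq> 0"
  then have "0 \<in> keys (p * single v c)"
    by (simp add: in_keys_iff)
  then obtain u where "0 = u + v"
    using keys_mult[of p "single v c"] by (auto split: if_splits)
  then have "ye (0::bic) i = ye (u + v) i"
    by simp
  then show False
    using assms by simp
qed

text \<open>Every term subtracted from 1 ends in some y, so the constant coefficient survives; in
  particular corners are nonzero.\<close>

lemma lookup_corner_zero: "lookup (corner I m) 0 = (1 :: 'k::field)"
proof (induction m)
  case (Suc m)
  have "lookup (corner I m * bmon (xpow {m} 1) * bmon (ypow {m} 1)) 0 = (0 :: 'k)"
    by (rule lookup_mult_single_zero[of _ m]) simp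
  then show ?case
    using Suc by (simp add: std_unit_def right_diff_distrib mult.assoc lookup_minus)
qed simp

text \<open>The y's of \<open>J\<close> commute with this corner and have the x's of
  \<open>J\<close> as right inverse, so killing the corner would make it zero.\<close>

lemma corner_notin_std_prime:
  assumes "I \<inter> J = {}"
  shows "(corner I n :: bic \<Rightarrow>\<^sub>0 'k::field) \<notin> std_prime n J"
proof
  assume "(corner I n :: bic \<Rightarrow>\<^sub>0 'k) \<in> std_prime n J"
  then obtain N where "bmon (ypow J N) * (corner I n :: bic \<Rightarrow>\<^sub>0 'k) = 0"
    by (auto simp: std_prime_def)
  then have "corner I n * bmon (ypow J N) = (0 :: bic \<Rightarrow>\<^sub>0 'k)"
    using assms by (subst corner_commute) auto
  moreover have "corner I n * bmon (ypow J N + xpow J N)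
      = (corner I n * bmon (ypow J N) * bmon (xpow J N) :: bic \<Rightarrow>\<^sub>0 'k)"
    by (simp add: mult_single mult.assoc)
  ultimately have "corner I n = (0 :: bic \<Rightarrow>\<^sub>0 'k)"
    by (simp add: ypow_xpow)
  then show False
    using lookup_corner_zero[of I n, where 'k = 'k] by simp
qed

text \<open>Homogeneity in the first \<open>m\<close> coordinates only, so that it can be acquired
  by induction on \<open>m\<close>, starting from the vacuous case 0.\<close>

definition homog :: "nat \<Rightarrow> (bic \<Rightarrow>\<^sub>0 'k::field) \<Rightarrow> bool" where
  "homog m p \<longleftrightarrow> (\<exists>\<delta>. \<forall>u\<in>keys p. \<forall>i<m. wt i u = \<delta> i)"

text \<open>After multiplying by a power of the \<open>y\<^sub>j\<close> with \<open>j \<in> J\<close>, the monomial \<open>u\<close> of \<open>f\<close> with the fewest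
  \<open>x\<close>-factors is isolated by \<open>corner * y\<^bsup>xe u\<^esup> _ x\<^bsup>ye u\<^esup>\<close>: homogeneity leaves a factor \<open>x\<^sub>i\<close>, which the
  corner kills, on the left of every other monomial.\<close>

lemma homog_notin_std_prime:
  assumes J: "J \<subseteq> {..<n}" and f: "f \<in> bic_alg n" "homog n f" "f \<notin> std_prime n J"
  obtains l r c where "l \<in> bic_alg n" "r \<in> bic_alg n" "c \<noteq> 0"
    "corner ({..<n} - J) n * l * f * r = single 0 c * corner ({..<n} - J) n"
proof -
  \<comment> \<open>\<open>N\<close> bounds all x-exponents in \<open>f\<close>, so no x_j with
    \<open>j\<close> in \<open>J\<close> survives in \<open>g\<close>.\<close>
  define N where "N = (\<Sum>u\<in>keys f. \<Sum>i<n. xe u i)"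
  have N: "xe u i \<le> N" if "u \<in> keys f" "i < n" for u i
  proof -
    have "xe u i \<le> (\<Sum>i<n. xe u i)"
      using that by (intro member_le_sum) auto
    also have "\<dots> \<le> N"
      unfolding N_def using that by (intro member_le_sum[of _ _ "\<lambda>u. \<Sum>i<n. xe u i"]) auto
    finally show ?thesis .
  qed
  define g where "g = bmon (ypow J N) * f"
  have "g \<noteq> 0"
    using f by (auto simp: std_prime_def g_def)
  obtain \<delta> where \<delta>: "\<And>u i. u \<in> keys f \<Longrightarrow> i < n \<Longrightarrow> wt i u = \<delta> i"
    using f(2) by (auto simp: homog_def)
  have g_bic: "g \<in> bic_alg n"
    unfolding g_def using J f(1) by (intro bic_alg_mult bic_alg_single) auto
  have keys_g: "\<exists>u\<in>keys f. v = ypow J N + u" if "v \<in> keys g" for v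
    using that keys_mult[of "bmon (ypow J N)" f] by (auto simp: g_def split: if_splits)
  have g_J: "xe v i = 0" if "v \<in> keys g" "i \<in> J" for v i
    using keys_g[OF that(1)] N that(2) J by (auto simp: lessThan_def)
  have g_wt: "wt i v = wt i (ypow J N) + \<delta> i" if "v \<in> keys g" "i < n" for v i
    using keys_g[OF that(1)] \<delta> that(2) by auto
  have g_out: "xe v i = 0 \<and> ye v i = 0" if "v \<in> keys g" "n \<le> i" for v i
    using g_bic that by (auto simp: bic_alg_def)
  obtain u0 where "u0 \<in> keys g"
    using \<open>g \<noteq> 0\<close> poly_mapping_eqI[of g 0] by (auto simp: in_keys_iff)
  then obtain u where u: "u \<in> keys g"
    and u_min: "\<And>v. v \<in> keys g \<Longrightarrow> (\<Sum>i<n. xe u i) \<le> (\<Sum>i<n. xe v i)"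
    using ex_has_least_nat[of "\<lambda>u. u \<in> keys g" u0 "\<lambda>u. \<Sum>i<n. xe u i"] by blast
  \<comment> \<open>The multipliers are chosen to cancel \<open>u\<close> exactly:
    \<open>w u\<close> is the unit monomial.\<close>
  define w where "w v = Bic (\<lambda>_. 0) (xe u) + v + Bic (ye u) (\<lambda>_. 0)" for v
  let ?e = "corner ({..<n} - J) n :: bic \<Rightarrow>\<^sub>0 'a"
  have wt_eq: "int (xe v i) - int (ye v i) = int (xe u i) - int (ye u i)"
    if "v \<in> keys g" for v i
    using g_wt[OF that, of i] g_wt[OF u, of i] g_out[OF that, of i] g_out[OF u, of i]
    by (cases "i < n") (auto simp: wt_def)
  have w_u: "w u = 0"
    by (rule bic_eqI) (auto simp: w_def)
  have kill: "?e * single (w v) c = 0" if v: "v \<in> keys g" "v \<noteq> u" for v c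
  proof -
    \<comment> \<open>Otherwise the x-exponents of \<open>v\<close> are bounded by those of
      \<open>u\<close>; minimality makes them equal, and equal degrees then force
      \<open>v = u\<close>.\<close>
    have "\<exists>i<n. xe u i < xe v i"
    proof (rule ccontr)
      assume "\<not> ?thesis"
      then have le: "\<And>i. i < n \<Longrightarrow> xe v i \<le> xe u i"
        by (meson not_le_imp_less)
      have eq: "xe v i = xe u i" if "i < n" for i
      proof (rule ccontr)
        assume "xe v i \<noteq> xe u i"
        then have "(\<Sum>i<n. xe v i) < (\<Sum>i<n. xe u i)"
          using le that by (intro sum_strict_mono_ex1) (auto simp: order_less_le)
        then show False
          using u_min[OF v(1)] by simp
      qed
      have "v = u"
      proof (rule bic_eqI)
        show x: "xe v i = xe u i" for i
          using eq g_out[OF v(1)] g_out[OF u] by (cases "i < n") auto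
        show "ye v i = ye u i" for i
          using wt_eq[OF v(1), of i] x[of i] by simp
      qed
      then show False
        using v(2) by simp
    qed
    then obtain i where i: "i < n" "xe u i < xe v i"
      by blast
    then have "i \<notin> J"
      using g_J[OF v(1)] by fastforce
    moreover have "xe (w v) i > 0"
      using i(2) by (simp add: w_def)
    ultimately show ?thesis
      using i(1) by (intro corner_kill[of i]) auto
  qed
  let ?l = "bmon (Bic (\<lambda>_. 0) (xe u))" and ?r = "bmon (Bic (ye u) (\<lambda>_. 0))"
  have "?e * ?l * g * ?r = ?e * ?l * (\<Sum>v\<in>keys g. single v (lookup g v)) * ?r"
    by (simp add: sum_single_keys)
  also have "\<dots> = (\<Sum>v\<in>keys g. ?e * single (w v) (lookup g v))"
    by (simp add: sum_distrib_left sum_distrib_right mult_single w_def mult.assoc add.assoc)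
  also have "\<dots> = (\<Sum>v\<in>keys g. if v = u then ?e * single 0 (lookup g u) else 0)"
    by (rule sum.cong) (auto simp: w_u kill)
  also have "\<dots> = ?e * single 0 (lookup g u)"
    using u by simp
  also have "\<dots> = single 0 (lookup g u) * ?e"
    by (rule corner_commute) auto
  finally have "?e * (?l * bmon (ypow J N)) * f * ?r = single 0 (lookup g u) * ?e"
    by (simp add: g_def mult.assoc)
  moreover have "?l * bmon (ypow J N) \<in> bic_alg n" "?r \<in> bic_alg n"
    using J g_out[OF u] by (auto intro!: bic_alg_mult bic_alg_single)
  moreover have "lookup g u \<noteq> 0"
    using u by (simp add: in_keys_iff)
  ultimately show ?thesis
    using that by blast
qed

section \<open>Idempotent ideals are graded\<close>

text \<open>Discrete polynomials of degree less than \<open>k\<close>, defined by vanishing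
  differences. In characteristic p, binomial coefficient functions have this property without being
  polynomial functions over the field.\<close>

primrec fin_degree :: "nat \<Rightarrow> (int \<Rightarrow> 'k::field) \<Rightarrow> bool" where
  "fin_degree 0 \<beta> \<longleftrightarrow> (\<forall>s. \<beta> s = 0)"
| "fin_degree (Suc k) \<beta> \<longleftrightarrow> (\<forall>t. fin_degree k (\<lambda>s. \<beta> (s + t) - \<beta> s))"

lemma fin_degree_add:
  "fin_degree k \<beta> \<Longrightarrow> fin_degree k \<gamma> \<Longrightarrow> fin_degree k (\<lambda>s. \<beta> s + \<gamma> s)"
proof (induction k arbitrary: \<beta> \<gamma>)
  case (Suc k)
  have "fin_degree k (\<lambda>s. (\<beta> (s + t) - \<beta> s) + (\<gamma> (s + t) - \<gamma> s))" for t
    using Suc.prems by (intro Suc.IH) auto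
  then show ?case
    by (simp add: algebra_simps)
qed simp

lemma fin_degree_cmult: "fin_degree k \<beta> \<Longrightarrow> fin_degree k (\<lambda>s. c * \<beta> s)"
proof (induction k arbitrary: \<beta>)
  case (Suc k)
  have "fin_degree k (\<lambda>s. c * (\<beta> (s + t) - \<beta> s))" for t
    using Suc.prems by (intro Suc.IH) auto
  then show ?case
    by (simp add: algebra_simps)
qed simp

lemma fin_degree_shift: "fin_degree k \<beta> \<Longrightarrow> fin_degree k (\<lambda>s. \<beta> (s + a))"
proof (induction k arbitrary: \<beta>)
  case (Suc k)
  have "fin_degree k (\<lambda>s. \<beta> (s + a + t) - \<beta> (s + a))" for t
    using Suc.IH[of "\<lambda>s. \<beta> (s + t) - \<beta> s"] Suc.prems by simp
  then show ?case
    by (simp add: ac_simps)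
qed simp

lemma fin_degree_Suc: "fin_degree k \<beta> \<Longrightarrow> fin_degree (Suc k) \<beta>"
  by (induction k arbitrary: \<beta>) auto

lemma fin_degree_mono: "fin_degree k \<beta> \<Longrightarrow> k \<le> l \<Longrightarrow> fin_degree l \<beta>"
  by (induction l rule: nat_induct) (auto simp: le_Suc_eq simp del: fin_degree.simps intro: fin_degree_Suc)

text \<open>The recurrence concerns step 1 only; a difference with step \<open>t\<close> is a signed
  sum of shifts of \<open>b\<close>, built by induction on \<open>t\<close> in both
  directions.\<close>

lemma fin_degree_antidifference:
  assumes B: "\<And>s. B (s + 1) = B s + b s" and b: "fin_degree k b"
  shows "fin_degree (Suc k) B"
proof -
  have "fin_degree k (\<lambda>s. B (s + t) - B s)" for t
  proof (induction t rule: int_induct[of _ 0])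
    case base
    show ?case
      using fin_degree_cmult[OF b, of 0] by simp
  next
    case (step1 t)
    have "fin_degree k (\<lambda>s. (B (s + t) - B s) + b (s + t))"
      by (intro fin_degree_add fin_degree_shift step1 b)
    moreover have "(B (s + t) - B s) + b (s + t) = B (s + (t + 1)) - B s" for s
      using B[of "s + t"] by (simp add: ac_simps)
    ultimately show ?case
      by simp
  next
    case (step2 t)
    have "fin_degree k (\<lambda>s. (B (s + t) - B s) + (-1) * b (s + (t - 1)))"
      by (intro fin_degree_add fin_degree_shift fin_degree_cmult step2 b)
    moreover have "(B (s + t) - B s) + (-1) * b (s + (t - 1)) = B (s + (t - 1)) - B s" for s
      using B[of "s + (t - 1)"] by (simp add: ac_simps)
    ultimately show ?case
      by (simp only:)
  qed
  then show ?thesis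
    by simp
qed

lemma ex_antidifference:
  fixes b :: "int \<Rightarrow> 'k::field"
  obtains B where "B 0 = 0" "\<And>s. B (s + 1) = B s + b s"
proof -
  \<comment> \<open>For negative \<open>s\<close> the values of \<open>b\<close> at -1 down to
    \<open>s\<close> are subtracted, so the recurrence also holds across 0.\<close>
  define B where "B s = (if s \<ge> 0 then \<Sum>j<nat s. b (int j) else - (\<Sum>j<nat (- s). b (- 1 - int j)))" for s
  have "B 0 = 0"
    by (simp add: B_def)
  moreover have "B (s + 1) = B s + b s" for s
  proof (cases "s \<ge> 0")
    case True
    then show ?thesis
      by (simp add: B_def nat_add_distrib)
  next
    case False
    define m where "m = nat (- s - 1)"
    have s: "s = - 1 - int m"
      using False by (simp add: m_def)
    have "nat (- s) = Suc m" "nat (- (s + 1)) = m"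
      using s by auto
    then show ?thesis
      using s False by (cases "m = 0") (auto simp: B_def)
  qed
  ultimately show ?thesis
    by (rule that)
qed

text \<open>The witness is the binomial coefficient function \<open>s \<mapsto> s choose k\<close>.\<close>

lemma ex_fin_degree_top:
  "\<exists>\<beta> :: int \<Rightarrow> 'k::field. fin_degree (Suc k) \<beta> \<and> \<beta> (int k) = 1 \<and> (\<forall>j<k. \<beta> (int j) = 0)"
proof (induction k)
  case 0
  show ?case
    by (rule exI[of _ "\<lambda>_. 1"]) simp
next
  case (Suc k)
  then obtain \<beta> :: "int \<Rightarrow> 'k" where
    \<beta>: "fin_degree (Suc k) \<beta>" "\<beta> (int k) = 1" "\<And>j. j < k \<Longrightarrow> \<beta> (int j) = 0"
    by blast
  obtain B where B: "B 0 = 0" "\<And>s. B (s + 1) = B s + \<beta> s"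
    using ex_antidifference by blast
  have sum: "B (int j) = (\<Sum>i<j. \<beta> (int i))" for j
    by (induction j) (use B in \<open>auto simp: add.commute[of 1]\<close>)
  have "B (int j) = 0" if "j < Suc k" for j
    unfolding sum using that \<beta>(3) by (intro sum.neutral) auto
  moreover have "B (int (Suc k)) = 1"
    unfolding sum using \<beta>(2,3) by simp
  moreover have "fin_degree (Suc (Suc k)) B"
    using B(2) \<beta>(1) by (rule fin_degree_antidifference)
  ultimately show ?case
    by blast
qed

text \<open>Newton interpolation: the shifted binomial vanishes at earlier nodes and is 1 at the new
  one. No division by differences of nodes occurs, as these may vanish in the field.\<close>

lemma ex_fin_degree_interpolation:
  fixes \<phi> :: "int \<Rightarrow> 'k::field"
  shows "\<exists>\<beta> k. fin_degree k \<beta> \<and> (\<forall>j<M. \<beta> (a + int j) = \<phi> (a + int j))"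
proof (induction M)
  case 0
  show ?case
    by (rule exI[of _ "\<lambda>_. 0"], rule exI[of _ 0]) simp
next
  case (Suc M)
  then obtain \<beta> k where \<beta>: "fin_degree k \<beta>" "\<And>j. j < M \<Longrightarrow> \<beta> (a + int j) = \<phi> (a + int j)"
    by blast
  obtain \<gamma> :: "int \<Rightarrow> 'k" where
    \<gamma>: "fin_degree (Suc M) \<gamma>" "\<gamma> (int M) = 1" "\<And>j. j < M \<Longrightarrow> \<gamma> (int j) = 0"
    using ex_fin_degree_top by blast
  define c where "c = \<phi> (a + int M) - \<beta> (a + int M)"
  define \<beta>' where "\<beta>' s = \<beta> s + c * \<gamma> (s + (- a))" for s
  have "fin_degree (max k (Suc M)) \<beta>'"
    unfolding \<beta>'_def
    by (intro fin_degree_add fin_degree_cmult fin_degree_shift)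
      (rule fin_degree_mono[OF \<beta>(1)] fin_degree_mono[OF \<gamma>(1)], simp)+
  moreover have "\<beta>' (a + int j) = \<phi> (a + int j)" if "j < Suc M" for j
    using that \<beta>(2) \<gamma>(2,3) by (auto simp: \<beta>'_def c_def less_Suc_eq)
  ultimately show ?case
    by blast
qed

lemma ex_fin_degree_finite:
  fixes \<phi> :: "int \<Rightarrow> 'k::field"
  assumes "finite W"
  obtains \<beta> k where "fin_degree k \<beta>" "\<And>s. s \<in> W \<Longrightarrow> \<beta> s = \<phi> s"
proof -
  obtain \<beta> k where \<beta>: "fin_degree k \<beta>"
    "\<And>j. j < nat (Max W - Min W + 1) \<Longrightarrow> \<beta> (Min W + int j) = \<phi> (Min W + int j)"
    using ex_fin_degree_interpolation by blast
  have "\<beta> s = \<phi> s" if "s \<in> W" for s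
  proof -
    have "Min W \<le> s" "s \<le> Max W"
      using that assms by auto
    then show ?thesis
      using \<beta>(2)[of "nat (s - Min W)"] by (simp add: nat_less_iff)
  qed
  with \<beta>(1) show ?thesis
    using that by blast
qed

text \<open>\<open>A \<subseteq> A\<^sup>2\<close>, phrased without introducing products of ideals.\<close>

definition mult_generated :: "(bic \<Rightarrow>\<^sub>0 'k::field) set \<Rightarrow> bool" where
  "mult_generated A \<longleftrightarrow> (\<forall>X. additive_closed X \<and> (\<forall>g\<in>A. \<forall>h\<in>A. g * h \<in> X) \<longrightarrow> A \<subseteq> X)"

text \<open>The operator \<open>f \<mapsto> scale (\<beta> \<circ> wt i) f\<close> satisfies a Leibniz rule whose correction terms involve
  the differences of \<open>\<beta>\<close>, hence functions of smaller degree. For \<open>\<beta> = (choose k)\<close> it is a divided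
  power of a derivation, so \<open>A = A\<^sup>k\<^sup>+\<^sup>1\<close> makes it preserve \<open>A\<close> in every characteristic.\<close>

lemma scale_fin_degree_in_idempotent:
  assumes A: "two_sided n A" "mult_generated A" and \<beta>: "fin_degree k \<beta>" and f: "f \<in> A"
  shows "scale (\<lambda>u. \<beta> (wt i u)) f \<in> A"
  using \<beta> f
proof (induction k arbitrary: \<beta> f)
  case 0
  then show ?case
    using two_sidedD(2)[OF A(1)] by simp
next
  case (Suc k)
  let ?s = "scale (\<lambda>u. \<beta> (wt i u))"
  \<comment> \<open>For a monomial \<open>h\<close> the correction applies a difference of
    \<open>\<beta>\<close> to \<open>g\<close>, which the induction hypothesis keeps in
    \<open>A\<close>.\<close>
  have leibniz: "?s (g * h) - ?s g * h \<in> A" if g: "g \<in> A" and h: "h \<in> bic_alg n" for g h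
  proof (rule poly_single_induct[where p = h])
    have "?s (g * (p + q)) - ?s g * (p + q) = (?s (g * p) - ?s g * p) + (?s (g * q) - ?s g * q)" for p q
      by (simp add: distrib_left)
    then show "additive_closed {h. ?s (g * h) - ?s g * h \<in> A}"
      using two_sidedD(2,3)[OF A(1)] unfolding additive_closed_def by simp
    fix v assume v: "v \<in> keys h"
    let ?h = "single v (lookup h v)"
    have "?s (g * ?h) - ?s g * ?h = scale (\<lambda>u. \<beta> (wt i u + wt i v) - \<beta> (wt i u)) g * ?h"
      by (simp add: scale_mult_single scale_diff_fun left_diff_distrib)
    moreover have "scale (\<lambda>u. \<beta> (wt i u + wt i v) - \<beta> (wt i u)) g \<in> A"
      using Suc.IH[OF _ g, of "\<lambda>s. \<beta> (s + wt i v) - \<beta> s"] Suc.prems(1) by simp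
    ultimately show "?s (g * ?h) - ?s g * ?h \<in> A"
      using two_sidedD(5)[OF A(1) bic_alg_single_keys[OF h v]] by simp
  qed
  have "A \<subseteq> {f. ?s f \<in> A}"
  proof (rule A(2)[unfolded mult_generated_def, rule_format], intro conjI ballI CollectI)
    show "additive_closed {f. ?s f \<in> A}"
      using two_sidedD(2,3)[OF A(1)] by (auto simp: additive_closed_def)
    fix g h assume gh: "g \<in> A" "h \<in> A"
    \<comment> \<open>\<open>?s g\<close> is not known to lie in \<open>A\<close>; the second factor
      \<open>h\<close> puts the product there. This is where \<open>A\<close> being generated by its
      products enters.\<close>
    have "?s g * h \<in> A"
      using gh two_sidedD(1,4)[OF A(1)] by simp
    then have "(?s (g * h) - ?s g * h) + ?s g * h \<in> A"
      using leibniz gh two_sidedD(1,3)[OF A(1)] by blast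
    then show "?s (g * h) \<in> A"
      by simp
  qed
  then show ?case
    using Suc.prems(2) by blast
qed

text \<open>Only finitely many degrees occur in \<open>f\<close>, and on them the indicator of
  \<open>d\<close> agrees with a function of finite degree.\<close>

lemma part_in_idempotent:
  fixes f :: "bic \<Rightarrow>\<^sub>0 'k::field"
  assumes A: "two_sided n A" "mult_generated A" and f: "f \<in> A"
  shows "part (\<lambda>u. wt i u = d) f \<in> A"
proof -
  obtain \<beta> :: "int \<Rightarrow> 'k" and k where
    \<beta>: "fin_degree k \<beta>" "\<And>s. s \<in> wt i ` keys f \<Longrightarrow> \<beta> s = (if s = d then 1 else 0)"
    by (rule ex_fin_degree_finite[OF finite_imageI[OF finite_keys[of f]],
          where \<phi> = "\<lambda>s. if s = d then 1 else 0"]) blast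
  have "part (\<lambda>u. wt i u = d) f = scale (\<lambda>u. \<beta> (wt i u)) f"
    unfolding part_def by (rule scale_cong) (simp add: \<beta>(2))
  then show ?thesis
    using scale_fin_degree_in_idempotent[OF A \<beta>(1) f] by simp
qed

definition graded :: "nat \<Rightarrow> (bic \<Rightarrow>\<^sub>0 'k::field) set \<Rightarrow> bool" where
  "graded n A \<longleftrightarrow> (\<forall>f\<in>A. \<forall>i<n. \<forall>d. part (\<lambda>u. wt i u = d) f \<in> A)"

lemma homog_part_Suc:
  assumes "homog m f"
  shows "homog (Suc m) (part (\<lambda>u. wt m u = d) f)"
proof -
  obtain \<delta> where "\<forall>u\<in>keys f. \<forall>i<m. wt i u = \<delta> i"
    using assms by (auto simp: homog_def)
  then show ?thesis
    unfolding homog_def by (intro exI[of _ "\<delta>(m := d)"]) (auto simp: keys_part less_Suc_eq)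
qed

text \<open>Split in one coordinate after another; each time some component stays outside
  \<open>Q\<close>, and earlier homogeneity is preserved.\<close>

lemma ex_homog_notin:
  assumes A: "graded n A" and Q: "additive_closed Q" and f: "f \<in> A" "f \<notin> Q"
  obtains g where "g \<in> A" "g \<notin> Q" "homog n g"
proof -
  have "\<exists>g\<in>A. g \<notin> Q \<and> homog m g" if "m \<le> n" for m
    using that
  proof (induction m)
    case 0
    then show ?case
      using f by (auto simp: homog_def)
  next
    case (Suc m)
    then obtain g where g: "g \<in> A" "g \<notin> Q" "homog m g"
      by auto
    obtain d where "part (\<lambda>u. wt m u = d) g \<notin> Q"
      using ex_part_notin[OF Q g(2)] .
    moreover have "part (\<lambda>u. wt m u = d) g \<in> A"
      using A g(1) Suc.prems by (auto simp: graded_def)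
    ultimately show ?case
      using homog_part_Suc[OF g(3)] by blast
  qed
  then show ?thesis
    using that by blast
qed

section \<open>Primality and separation\<close>

text \<open>Degrees add, so the extreme degree of the product is reached only by extreme monomials
  of both outer factors.\<close>

lemma part_mult_top:
  fixes p q :: "bic \<Rightarrow>\<^sub>0 'k::field"
  assumes p: "\<And>u. u \<in> keys p \<Longrightarrow> wt i u \<le> d" and q: "\<And>u. u \<in> keys q \<Longrightarrow> wt i u \<le> e"
  shows "part (\<lambda>u. wt i u = d + wt i v + e) (p * single v c * q)
    = part (\<lambda>u. wt i u = d) p * single v c * part (\<lambda>u. wt i u = e) q"
proof -
  let ?t = "\<lambda>d. part (\<lambda>u. wt i u = d)"
  have single: "?t d (single u a) = (if wt i u = d then single u a else 0)" for d u and a :: 'k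
    by (auto simp: part_def)
  have zero: "?t d 0 = (0 :: bic \<Rightarrow>\<^sub>0 'k)" for d
    by (simp add: part_def)
  show ?thesis
  proof (rule poly_single_induct[where p = p])
    show "additive_closed {p. ?t (d + wt i v + e) (p * single v c * q) = ?t d p * single v c * ?t e q}"
      by (auto simp: additive_closed_def distrib_right zero)
    fix u assume u: "u \<in> keys p"
    show "?t (d + wt i v + e) (single u (lookup p u) * single v c * q)
      = ?t d (single u (lookup p u)) * single v c * ?t e q"
    proof (rule poly_single_induct[where p = q])
      show "additive_closed {q. ?t (d + wt i v + e) (single u (lookup p u) * single v c * q)
        = ?t d (single u (lookup p u)) * single v c * ?t e q}"
        by (auto simp: additive_closed_def distrib_left zero)
      fix w assume "w \<in> keys q"
      then have "wt i u + wt i v + wt i w = d + wt i v + e \<longleftrightarrow> wt i u = d \<and> wt i w = e"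
        using p[OF u] q[of w] by auto
      then show "?t (d + wt i v + e) (single u (lookup p u) * single v c * single w (lookup q w))
        = ?t d (single u (lookup p u)) * single v c * ?t e (single w (lookup q w))"
        by (auto simp: single mult_single)
    qed
  qed
qed

text \<open>\<open>d\<close> is the largest degree whose component lies outside \<open>P\<close>;
  all higher components together lie in \<open>P\<close>.\<close>

lemma ex_top_part:
  fixes f :: "bic \<Rightarrow>\<^sub>0 'k::field"
  assumes P: "two_sided n P" and f: "f \<in> bic_alg n" "f \<notin> P"
  obtains d where "part (\<lambda>u. wt i u = d) f \<notin> P" "f - part (\<lambda>u. wt i u \<le> d) f \<in> P"
proof -
  define D where "D = {d. part (\<lambda>u. wt i u = d) f \<notin> P}"
  have "D \<subseteq> wt i ` keys f"
  proof
    fix d assume "d \<in> D"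
    then have "part (\<lambda>u. wt i u = d) f \<noteq> 0"
      using two_sidedD(2)[OF P] by (auto simp: D_def)
    then show "d \<in> wt i ` keys f"
      using part_none[of f "\<lambda>u. wt i u = d"] by (auto simp: image_iff)
  qed
  then have fin: "finite D"
    by (rule finite_subset) simp
  obtain d0 where "d0 \<in> D"
    unfolding D_def by (metis ex_part_notin[OF two_sidedD(6)[OF P] f(2)] mem_Collect_eq)
  then have "Max D \<in> D"
    using fin by (intro Max_in) auto
  moreover have "part (\<lambda>u. wt i u \<in> {Max D<..}) f \<in> P"
  proof (rule part_in_additive_closed[OF two_sidedD(6)[OF P]])
    fix d assume "d \<in> {Max D<..}"
    then have "d \<notin> D"
      using Max_ge[OF fin] by fastforce
    then show "part (\<lambda>u. wt i u = d) f \<in> P"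
      by (simp add: D_def)
  qed
  moreover have "part (\<lambda>u. wt i u \<in> {Max D<..}) f = f - part (\<lambda>u. wt i u \<le> Max D) f"
    by (rule poly_mapping_eqI) (auto simp: lookup_part lookup_minus)
  ultimately show ?thesis
    by (intro that[of "Max D"]) (simp_all add: D_def)
qed

lemma part_part_le: "part (\<lambda>u. wt i u = d) (part (\<lambda>u. wt i u \<le> d) f) = part (\<lambda>u. wt i u = d) f"
  by (rule poly_mapping_eqI) (auto simp: lookup_part)

text \<open>Modulo \<open>P\<close>, both elements may be truncated above their last component
  outside \<open>P\<close>. Gradedness then puts the top component of each product into
  \<open>P\<close>.\<close>

lemma graded_prime_leading_parts:
  fixes f g :: "bic \<Rightarrow>\<^sub>0 'k::field"
  assumes P: "two_sided n P" "graded n P" and i: "i < n"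
    and f: "f \<in> bic_alg n" "f \<notin> P" and g: "g \<in> bic_alg n" "g \<notin> P"
    and fg: "\<And>h. h \<in> bic_alg n \<Longrightarrow> f * h * g \<in> P"
  obtains d e where "part (\<lambda>u. wt i u = d) f \<notin> P" "part (\<lambda>u. wt i u = e) g \<notin> P"
    "\<And>h. h \<in> bic_alg n \<Longrightarrow> part (\<lambda>u. wt i u = d) f * h * part (\<lambda>u. wt i u = e) g \<in> P"
proof -
  let ?lo = "\<lambda>d. part (\<lambda>u. wt i u \<le> d)" and ?t = "\<lambda>d. part (\<lambda>u. wt i u = d)"
  obtain d where d: "?t d f \<notin> P" "f - ?lo d f \<in> P"
    by (rule ex_top_part[OF P(1) f, of i])
  obtain e where e: "?t e g \<notin> P" "g - ?lo e g \<in> P"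
    by (rule ex_top_part[OF P(1) g, of i])
  have lo: "?lo d f * h * ?lo e g \<in> P" if h: "h \<in> bic_alg n" for h
  proof -
    have "(f - ?lo d f) * (h * g) \<in> P"
      by (rule two_sidedD(5)[OF P(1) _ d(2)]) (simp add: g h)
    moreover have "?lo d f * h * (g - ?lo e g) \<in> P"
      by (rule two_sidedD(4)[OF P(1) _ e(2)]) (simp add: f h)
    ultimately have "f * h * g - (f - ?lo d f) * (h * g) - ?lo d f * h * (g - ?lo e g) \<in> P"
      using fg[OF h] by (intro two_sided_diff[OF P(1)])
    moreover have "f * h * g - (f - ?lo d f) * (h * g) - ?lo d f * h * (g - ?lo e g) = ?lo d f * h * ?lo e g"
      by (simp add: left_diff_distrib right_diff_distrib mult.assoc)
    ultimately show ?thesis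
      by (simp only:)
  qed
  \<comment> \<open>For a monomial \<open>h\<close> the top component of the truncated product is
    the product of the top components; general \<open>h\<close> follows by additivity.\<close>
  have "?t d f * h * ?t e g \<in> P" if h: "h \<in> bic_alg n" for h
  proof (rule poly_single_induct[where p = h])
    show "additive_closed {h. ?t d f * h * ?t e g \<in> P}"
      using two_sidedD(2,3)[OF P(1)] by (auto simp: additive_closed_def distrib_left distrib_right)
    fix v assume v: "v \<in> keys h"
    have "?t (d + wt i v + e) (?lo d f * single v (lookup h v) * ?lo e g) \<in> P"
      using lo[OF bic_alg_single_keys[OF h v]] P(2) i by (auto simp: graded_def)
    also have "?t (d + wt i v + e) (?lo d f * single v (lookup h v) * ?lo e g)
        = ?t d f * single v (lookup h v) * ?t e g"
      by (subst part_mult_top) (simp_all add: keys_part part_part_le)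
    finally show "?t d f * single v (lookup h v) * ?t e g \<in> P" .
  qed
  with d(1) e(1) show ?thesis
    by (rule that)
qed

lemma graded_std_prime: "graded n (std_prime n J)"
  by (simp add: graded_def std_prime_part)

lemma two_sided_single_cancel:
  assumes A: "two_sided n A" and c: "c \<noteq> 0" "single 0 c * x \<in> A"
  shows "x \<in> A"
proof -
  have "single 0 (inverse c) * (single 0 c * x) \<in> A"
    by (rule two_sidedD(4)[OF A _ c(2)]) simp
  then show ?thesis
    using c(1) by (simp add: mult_single flip: mult.assoc)
qed

text \<open>Primality on elements: a counterexample could be made homogeneous by passing to leading
  parts, and homogeneous elements outside the prime reduce to nonzero multiples of a corner, which
  is also outside.\<close>

lemma std_prime_is_prime:
  fixes f g :: "bic \<Rightarrow>\<^sub>0 'k::field"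
  assumes J: "J \<subseteq> {..<n}"
    and f: "f \<in> bic_alg n" "f \<notin> std_prime n J" and g: "g \<in> bic_alg n" "g \<notin> std_prime n J"
  obtains h where "h \<in> bic_alg n" "f * h * g \<notin> std_prime n J"
proof -
  let ?P = "std_prime n J :: (bic \<Rightarrow>\<^sub>0 'k) set"
  let ?e = "corner ({..<n} - J) n :: bic \<Rightarrow>\<^sub>0 'k"
  note P = two_sided_std_prime[OF J, where 'a = 'k] and gr = graded_std_prime[of n J, where 'a = 'k]
  have False if fg: "\<And>h. h \<in> bic_alg n \<Longrightarrow> f * h * g \<in> ?P"
  proof -
    have "\<exists>f g. f \<in> bic_alg n \<and> f \<notin> ?P \<and> g \<in> bic_alg n \<and> g \<notin> ?P \<and> homog m f \<and> homog m g
      \<and> (\<forall>h\<in>bic_alg n. f * h * g \<in> ?P)" if "m \<le> n" for m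
      using that
    proof (induction m)
      case 0
      have "homog 0 f" "homog 0 g"
        by (auto simp: homog_def)
      then show ?case
        using f g fg by (intro exI[of _ f] exI[of _ g]) simp
    next
      case (Suc m)
      then obtain f g where fg: "f \<in> bic_alg n" "f \<notin> ?P" "g \<in> bic_alg n" "g \<notin> ?P" "homog m f" "homog m g"
        "\<And>h. h \<in> bic_alg n \<Longrightarrow> f * h * g \<in> ?P"
        by auto
      obtain d e where "part (\<lambda>u. wt m u = d) f \<notin> ?P" "part (\<lambda>u. wt m u = e) g \<notin> ?P"
        "\<And>h. h \<in> bic_alg n \<Longrightarrow> part (\<lambda>u. wt m u = d) f * h * part (\<lambda>u. wt m u = e) g \<in> ?P"
        by (rule graded_prime_leading_parts[OF P gr _ fg(1-4,7), of m]) (use Suc.prems in simp_all)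
      then show ?case
        using fg(1,3) homog_part_Suc[OF fg(5)] homog_part_Suc[OF fg(6)]
        by (intro exI[of _ "part (\<lambda>u. wt m u = d) f"] exI[of _ "part (\<lambda>u. wt m u = e) g"]) simp
    qed
    from this[of n] obtain f g where fg: "f \<in> bic_alg n" "f \<notin> ?P" "g \<in> bic_alg n" "g \<notin> ?P"
      "homog n f" "homog n g" "\<And>h. h \<in> bic_alg n \<Longrightarrow> f * h * g \<in> ?P"
      by auto
    obtain l r c where 1: "l \<in> bic_alg n" "r \<in> bic_alg n" "c \<noteq> 0" "?e * l * f * r = single 0 c * ?e"
      by (rule homog_notin_std_prime[OF J fg(1,5,2)])
    obtain l' r' c' where 2: "l' \<in> bic_alg n" "r' \<in> bic_alg n" "c' \<noteq> 0" "?e * l' * g * r' = single 0 c' * ?e"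
      by (rule homog_notin_std_prime[OF J fg(3,6,4)])
    \<comment> \<open>The middle factor joins the two reductions: the first returns the corner that
      the second needs on its left.\<close>
    have "f * (r * l') * g \<in> ?P"
      by (rule fg(7)) (simp add: 1 2)
    then have "(?e * l) * (f * (r * l') * g) * r' \<in> ?P"
      using two_sidedD(4)[OF P, of "?e * l"] two_sidedD(5)[OF P 2(2)] 1(1) by simp
    also have "(?e * l) * (f * (r * l') * g) * r' = (?e * l * f * r) * l' * g * r'"
      by (simp add: mult.assoc)
    also have "\<dots> = single 0 c * (?e * l' * g * r')"
      by (simp only: 1(4) mult.assoc[of "single 0 c"])
    also have "\<dots> = single 0 c * (single 0 c' * ?e)"
      by (simp add: 2(4))
    finally have "?e \<in> ?P"
      by (rule two_sided_single_cancel[OF P 2(3) two_sided_single_cancel[OF P 1(3)]])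
    then show ?thesis
      using corner_notin_std_prime[of "{..<n} - J" J n] by auto
  qed
  then show ?thesis
    using that by blast
qed

section \<open>Separating graded ideals from elements by standard primes\<close>

lemma corner_notin_imp_subset:
  assumes J: "J \<subseteq> {..<n}" and A: "two_sided n A" "graded n A"
    and e: "corner ({..<n} - J) n \<notin> A"
  shows "A \<subseteq> std_prime n J"
proof
  fix f assume f: "f \<in> A"
  show "f \<in> std_prime n J"
  proof (rule ccontr)
    assume "f \<notin> std_prime n J"
    then obtain g where g: "g \<in> A" "g \<notin> std_prime n J" "homog n g"
      by (rule ex_homog_notin[OF A(2) additive_closed_std_prime f])
    obtain l r c where lr: "l \<in> bic_alg n" "r \<in> bic_alg n" "c \<noteq> 0"
      "corner ({..<n} - J) n * l * g * r = single 0 c * corner ({..<n} - J) n"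
      by (rule homog_notin_std_prime[OF J two_sidedD(1)[OF A(1) g(1)] g(3,2)])
    have "corner ({..<n} - J) n * l * g * r \<in> A"
      using two_sidedD(4)[OF A(1) _ g(1), of "corner ({..<n} - J) n * l"] two_sidedD(5)[OF A(1) lr(2)] lr(1)
      by simp
    then show False
      using e two_sided_single_cancel[OF A(1) lr(3)] unfolding lr(4) by blast
  qed
qed

text \<open>Telescoping \<open>1 = (\<Sum>j<N. x\<^sup>j (1 - x y) y\<^sup>j) + x\<^sup>N y\<^sup>N\<close>.\<close>

lemma std_unit_or_ypow_notin:
  fixes g :: "bic \<Rightarrow>\<^sub>0 'k::field"
  assumes A: "two_sided n A" and m: "m < n" and g: "g \<notin> A"
  shows "bmon (ypow {m} N) * g \<notin> A \<or> (\<exists>j. std_unit {m} 1 * bmon (ypow {m} j) * g \<notin> A)"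
proof (induction N)
  case 0
  have "ypow {m} 0 = 0"
    by (rule bic_eqI) auto
  then show ?case
    using g by simp
next
  case (Suc N)
  let ?z = "bmon (ypow {m} N) * g" and ?y = "bmon (ypow {m} (Suc N)) * g"
  have y: "ypow {m} (Suc N) = ypow {m} 1 + ypow {m} N"
    by (simp add: ypow_add)
  have z: "?z = std_unit {m} 1 * bmon (ypow {m} N) * g + bmon (xpow {m} 1) * ?y"
    by (simp add: std_unit_def left_diff_distrib mult_single y add.assoc flip: mult.assoc)
  show ?case
  proof (rule ccontr)
    assume neg: "\<not> ?thesis"
    have "bmon (xpow {m} 1) \<in> (bic_alg n :: (bic \<Rightarrow>\<^sub>0 'k) set)"
      using m by (intro bic_alg_single) auto
    then have "bmon (xpow {m} 1) * ?y \<in> A"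
      using neg two_sidedD(4)[OF A] by blast
    then have "?z \<in> A"
      using neg z two_sidedD(3)[OF A] by auto
    then show False
      using Suc neg by blast
  qed
qed

lemma corner_std_unit_commute: "corner I m * std_unit {m} N = std_unit {m} N * corner I m"
  by (simp add: std_unit_def mult_single left_diff_distrib right_diff_distrib corner_commute)

text \<open>Applying the telescoped 1 in each coordinate keeps some term outside \<open>A\<close>: a
  term with 1 - x_i y_i puts \<open>i\<close> into \<open>I\<close>, the tail contributes
  y_i^N.\<close>

lemma ex_corner_notin:
  fixes f :: "bic \<Rightarrow>\<^sub>0 'k::field"
  assumes A: "two_sided n A" and f: "f \<notin> A" and m: "m \<le> n"
  shows "\<exists>I k. I \<subseteq> {..<m} \<and> (\<forall>i<m. i \<notin> I \<longrightarrow> k i = N) \<and> (\<forall>i\<ge>m. k i = 0)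
    \<and> corner I m * bmon (Bic (\<lambda>_. 0) k) * f \<notin> A"
  using m
proof (induction m)
  case 0
  have "Bic (\<lambda>_. 0) (\<lambda>_. 0) = 0"
    by (rule bic_eqI) auto
  then show ?case
    using f by (intro exI[of _ "{}"] exI[of _ "\<lambda>_. 0"]) simp
next
  case (Suc m)
  then obtain I k where I: "I \<subseteq> {..<m}" "\<And>i. i < m \<Longrightarrow> i \<notin> I \<Longrightarrow> k i = N" "\<And>i. i \<ge> m \<Longrightarrow> k i = 0"
    and g: "corner I m * bmon (Bic (\<lambda>_. 0) k) * f \<notin> A"
    by auto
  have m_I: "m \<notin> I"
    using I(1) by auto
  have y: "bmon (ypow {m} j) * (corner I m * bmon (Bic (\<lambda>_. 0) k) * f)
      = corner I m * bmon (Bic (\<lambda>_. 0) (k(m := j))) * f" for j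
  proof -
    have "ypow {m} j + Bic (\<lambda>_. 0) k = Bic (\<lambda>_. 0) (k(m := j))"
      by (rule bic_eqI) (use I(3) in auto)
    then have "bmon (Bic (\<lambda>_. 0) (k(m := j))) = (bmon (ypow {m} j) * bmon (Bic (\<lambda>_. 0) k) :: bic \<Rightarrow>\<^sub>0 'k)"
      by (simp only: mult_single mult_1)
    moreover have "bmon (ypow {m} j) * corner I m = (corner I m * bmon (ypow {m} j) :: bic \<Rightarrow>\<^sub>0 'k)"
      by (rule corner_commute[symmetric]) (use m_I in auto)
    moreover have "bmon (ypow {m} j) * (corner I m * bmon (Bic (\<lambda>_. 0) k) * f)
        = (bmon (ypow {m} j) * corner I m) * bmon (Bic (\<lambda>_. 0) k) * f"
      by (simp only: mult.assoc)
    ultimately show ?thesis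
      by (simp only: mult.assoc)
  qed
  consider "bmon (ypow {m} N) * (corner I m * bmon (Bic (\<lambda>_. 0) k) * f) \<notin> A"
    | j where "std_unit {m} 1 * bmon (ypow {m} j) * (corner I m * bmon (Bic (\<lambda>_. 0) k) * f) \<notin> A"
    using std_unit_or_ypow_notin[OF A _ g, of m N] Suc.prems by auto
  then show ?case
  proof cases
    case 1
    then have "corner I m * bmon (Bic (\<lambda>_. 0) (k(m := N))) * f \<notin> A"
      unfolding y .
    moreover have "corner I (Suc m) = (corner I m :: bic \<Rightarrow>\<^sub>0 'k)"
      using m_I by simp
    ultimately have "corner I (Suc m) * bmon (Bic (\<lambda>_. 0) (k(m := N))) * f \<notin> A"
      by (simp only: not_False_eq_True)
    moreover have "I \<subseteq> {..<Suc m}" "\<forall>i<Suc m. i \<notin> I \<longrightarrow> (k(m := N)) i = N" "\<forall>i\<ge>Suc m. (k(m := N)) i = 0"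
      using I by (auto simp: less_Suc_eq)
    ultimately show ?thesis
      by blast
  next
    case (2 j)
    have "corner (insert m I) m = (corner I m :: bic \<Rightarrow>\<^sub>0 'k)"
      by (rule corner_cong) auto
    then have "corner (insert m I) (Suc m) = (std_unit {m} 1 * corner I m :: bic \<Rightarrow>\<^sub>0 'k)"
      by (simp add: corner_std_unit_commute)
    then have "corner (insert m I) (Suc m) * bmon (Bic (\<lambda>_. 0) (k(m := j))) * f \<notin> A"
      using 2 unfolding mult.assoc[of _ "bmon (ypow {m} j)"] y by (simp only: mult.assoc not_False_eq_True)
    moreover have "insert m I \<subseteq> {..<Suc m}" "\<forall>i<Suc m. i \<notin> insert m I \<longrightarrow> (k(m := j)) i = N"
      "\<forall>i\<ge>Suc m. (k(m := j)) i = 0"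
      using I by (auto simp: less_Suc_eq)
    ultimately show ?thesis
      by blast
  qed
qed

lemma graded_ideal_separation:
  fixes f :: "bic \<Rightarrow>\<^sub>0 'k::field"
  assumes A: "two_sided n A" "graded n A" and f: "f \<in> bic_alg n" "f \<notin> A"
  obtains J where "J \<subseteq> {..<n}" "A \<subseteq> std_prime n J" "f \<notin> std_prime n J"
proof -
  \<comment> \<open>\<open>N\<close> must be fixed before \<open>I\<close> is known, so one exponent
    is chosen for all of the finitely many subsets \<open>J\<close>.\<close>
  have "eventually (\<lambda>N. \<forall>J\<in>Pow {..<n}. f \<in> std_prime n J \<longrightarrow> bmon (ypow J N) * f = 0) sequentially"
  proof (intro eventually_ball_finite ballI)
    show "eventually (\<lambda>N. f \<in> std_prime n J \<longrightarrow> bmon (ypow J N) * f = 0) sequentially" for J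
      using std_prime_eventually[of f n J] by (cases "f \<in> std_prime n J") simp_all
  qed simp
  then obtain N where N: "\<And>J. J \<subseteq> {..<n} \<Longrightarrow> f \<in> std_prime n J \<Longrightarrow> bmon (ypow J N) * f = 0"
    unfolding eventually_sequentially by blast
  obtain I k where I: "I \<subseteq> {..<n}" "\<And>i. i < n \<Longrightarrow> i \<notin> I \<Longrightarrow> k i = N" "\<And>i. i \<ge> n \<Longrightarrow> k i = 0"
    and e: "corner I n * bmon (Bic (\<lambda>_. 0) k) * f \<notin> A"
    using ex_corner_notin[OF A(1) f(2), of n N] by auto
  have I': "{..<n} - ({..<n} - I) = I"
    using I(1) by auto
  have "corner I n \<notin> A"
  proof
    assume "corner I n \<in> A"
    moreover have "bmon (Bic (\<lambda>_. 0) k) \<in> (bic_alg n :: (bic \<Rightarrow>\<^sub>0 'k) set)"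
      using I(3) by (intro bic_alg_single) auto
    ultimately show False
      using e f(1) two_sidedD(5)[OF A(1)] by blast
  qed
  then have "A \<subseteq> std_prime n ({..<n} - I)"
    using corner_notin_imp_subset[OF _ A, of "{..<n} - I"] I' by auto
  moreover have "f \<notin> std_prime n ({..<n} - I)"
  proof
    assume "f \<in> std_prime n ({..<n} - I)"
    then have 0: "bmon (ypow ({..<n} - I) N) * f = 0"
      by (intro N) auto
    \<comment> \<open>Outside \<open>I\<close> all exponents equal \<open>N\<close>, so the
      annihilating power of the y's splits off next to \<open>f\<close>.\<close>
    have "Bic (\<lambda>_. 0) k = Bic (\<lambda>_. 0) (\<lambda>i. if i \<in> I then k i else 0) + ypow ({..<n} - I) N"
      by (rule bic_eqI) (use I in \<open>auto simp: not_less\<close>)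
    then have "bmon (Bic (\<lambda>_. 0) k) * f
        = bmon (Bic (\<lambda>_. 0) (\<lambda>i. if i \<in> I then k i else 0)) * (bmon (ypow ({..<n} - I) N) * f)"
      by (simp add: mult_single flip: mult.assoc)
    then have "corner I n * bmon (Bic (\<lambda>_. 0) k) * f = 0"
      using 0 by (simp add: mult.assoc)
    then show False
      using e two_sidedD(2)[OF A(1)] by simp
  qed
  ultimately show ?thesis
    using that[of "{..<n} - I"] by blast
qed

section \<open>Decomposition from a separating family of primes\<close>

text \<open>The decomposition argument uses only these properties of the standard primes; it is
  independent of the Jacobson algebra.\<close>

locale prime_separated_ring = ring R for R :: "('a, 'b) ring_scheme" (structure) +
  fixes F :: "'a set set"
  assumes finite_F: "finite F"
    and prime_F: "p \<in> F \<Longrightarrow> prime_ideal R p"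
    and inter_subset_prod: "p \<in> F \<Longrightarrow> ideal Q R \<Longrightarrow> p \<inter> Q \<subseteq> ideal_prod R p Q"
    and separation: "idempotent_ideal R a \<Longrightarrow> x \<in> carrier R \<Longrightarrow> x \<notin> a \<Longrightarrow> \<exists>p\<in>F. a \<subseteq> p \<and> x \<notin> p"
begin

lemma ideal_F: "p \<in> F \<Longrightarrow> ideal p R"
  using prime_F by (auto simp: prime_ideal_def)

lemma ideal_subset_carrier: "ideal I R \<Longrightarrow> I \<subseteq> carrier R"
  by (meson ideal.Icarr subsetI)

lemma prod_eq_inter: "p \<in> F \<Longrightarrow> ideal Q R \<Longrightarrow> ideal_prod R p Q = p \<inter> Q"
  using inter_subset_prod ideal_prod_inter[OF ideal_F] by blast

lemma idempotent_F: "p \<in> F \<Longrightarrow> idempotent_ideal R p"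
  using prod_eq_inter[OF _ ideal_F] ideal_F by (simp add: idempotent_ideal_def)

text \<open>Being an ideal is carried through the induction, because each step needs it of the
  remaining product.\<close>

lemma prod_list_eq_inter_list:
  "set qs \<subseteq> F \<Longrightarrow> ideal (ideal_prod_list R qs) R \<and> ideal_prod_list R qs = ideal_inter_list R qs"
proof (induction qs)
  case Nil
  then show ?case
    using oneideal by (simp add: ideal_inter_list_def)
next
  case (Cons I qs)
  then have I: "I \<in> F" and qs: "ideal (ideal_prod_list R qs) R" "ideal_prod_list R qs = ideal_inter_list R qs"
    by auto
  show ?case
  proof (cases qs)
    case Nil
    then show ?thesis
      using ideal_F[OF I] ideal_subset_carrier by (auto simp: ideal_inter_list_def)
  next
    case (Cons J Is)
    then have "ideal_prod_list R (I # qs) = ideal_prod R I (ideal_prod_list R qs)"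
      by simp
    moreover have "I \<inter> ideal_prod_list R qs = ideal_inter_list R (I # qs)"
      unfolding qs(2) by (auto simp: ideal_inter_list_def)
    ultimately show ?thesis
      using prod_eq_inter[OF I qs(1)] ideal_prod_is_ideal[OF ideal_F[OF I] qs(1)] by simp
  qed
qed

lemma prime_contains_factor:
  assumes "prime_ideal R q" "set qs \<subseteq> F" "ideal_prod_list R qs \<subseteq> q"
  shows "\<exists>p\<in>set qs. p \<subseteq> q"
  using assms(2,3)
proof (induction qs)
  case Nil
  then show ?case
    using assms(1) ideal_subset_carrier by (auto simp: prime_ideal_def)
next
  case (Cons I qs)
  show ?case
  proof (cases qs)
    case Nil
    then show ?thesis
      using Cons.prems by simp
  next
    case (Cons J Is)
    then have "ideal_prod R I (ideal_prod_list R qs) \<subseteq> q"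
      using Cons.prems by simp
    moreover have "ideal I R" "ideal (ideal_prod_list R qs) R"
      using Cons.prems ideal_F prod_list_eq_inter_list[of qs] by auto
    ultimately have "I \<subseteq> q \<or> ideal_prod_list R qs \<subseteq> q"
      using assms(1) unfolding prime_ideal_def by blast
    then show ?thesis
      using Cons.IH Cons.prems by auto
  qed
qed

lemma idempotent_eq_inter:
  assumes "idempotent_ideal R a"
  shows "a = carrier R \<inter> \<Inter>{p \<in> F. a \<subseteq> p}"
proof
  show "a \<subseteq> carrier R \<inter> \<Inter>{p \<in> F. a \<subseteq> p}"
    using assms ideal_subset_carrier by (auto simp: idempotent_ideal_def)
  show "carrier R \<inter> \<Inter>{p \<in> F. a \<subseteq> p} \<subseteq> a"
    using separation[OF assms] by blast
qed

text \<open>\<open>q\<close> is the product of the members of \<open>F\<close> above it; by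
  primality one of these lies below \<open>q\<close>, hence equals it.\<close>

lemma idempotent_prime_in_F:
  assumes "prime_ideal R q" "idempotent_ideal R q"
  shows "q \<in> F"
proof -
  obtain ps where ps: "set ps = {p \<in> F. q \<subseteq> p}"
    using finite_F finite_list[of "{p \<in> F. q \<subseteq> p}"] by auto
  then have "ideal_prod_list R ps = q"
    using prod_list_eq_inter_list[of ps] idempotent_eq_inter[OF assms(2)]
    by (auto simp: ideal_inter_list_def)
  then obtain p where "p \<in> set ps" "p \<subseteq> q"
    using prime_contains_factor[OF assms(1), of ps] ps by auto
  then show ?thesis
    using ps by auto
qed

lemma incomp_idem_primes_subset: "incomp_idem_primes R qs \<Longrightarrow> set qs \<subseteq> F"
  using idempotent_prime_in_F by (auto simp: incomp_idem_primes_def)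

text \<open>Incomparability is imposed on positions, so it also rules out repetitions.\<close>

lemma incomp_idem_primesD:
  assumes "incomp_idem_primes R qs"
  shows "p \<in> set qs \<Longrightarrow> q \<in> set qs \<Longrightarrow> p \<subseteq> q \<Longrightarrow> p = q" and "distinct qs"
  using assms unfolding incomp_idem_primes_def
  by (metis in_set_conv_nth) (metis assms distinct_conv_nth incomp_idem_primes_def order_refl)

text \<open>Every prime over \<open>a\<close> contains a factor, and factors are pairwise
  incomparable. Uniqueness follows, since the right-hand side depends on \<open>a\<close>
  alone.\<close>

lemma set_eq_min_primes:
  assumes "incomp_idem_primes R qs" "a = ideal_prod_list R qs"
  shows "set qs = min_primes R a"
proof -
  note F = incomp_idem_primes_subset[OF assms(1)]
  have prime: "prime_ideal R q" and sub: "a \<subseteq> q" if "q \<in> set qs" for q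
    using that F prime_F prod_list_eq_inter_list[OF F] assms(2) by (auto simp: ideal_inter_list_def)
  have factor: "\<exists>p\<in>set qs. p \<subseteq> Q" if "prime_ideal R Q" "a \<subseteq> Q" for Q
    using prime_contains_factor[OF that(1) F] that(2) assms(2) by blast
  show ?thesis
  proof (rule Set.set_eqI, rule iffI)
    fix q assume q: "q \<in> set qs"
    have "Q = q" if Q: "prime_ideal R Q" "a \<subseteq> Q" "Q \<subseteq> q" for Q
    proof -
      obtain p where p: "p \<in> set qs" "p \<subseteq> Q"
        using factor[OF Q(1,2)] by blast
      then have "p = q"
        using incomp_idem_primesD(1)[OF assms(1) _ q] Q(3) by blast
      then show ?thesis
        using p Q(3) by blast
    qed
    then show "q \<in> min_primes R a"
      using prime[OF q] sub[OF q] by (auto simp: min_primes_def)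
  next
    fix q assume q: "q \<in> min_primes R a"
    then obtain p where "p \<in> set qs" "p \<subseteq> q"
      using factor[of q] by (auto simp: min_primes_def)
    then show "q \<in> set qs"
      using q prime sub unfolding min_primes_def by blast
  qed
qed

lemma ex_decomposition:
  assumes "idempotent_ideal R a"
  obtains qs where "incomp_idem_primes R qs" "a = ideal_prod_list R qs"
proof -
  define G where "G = {p \<in> F. a \<subseteq> p}"
  \<comment> \<open>Every member of the finite set \<open>G\<close> lies above a minimal one, so
    passing to minimal members keeps the intersection.\<close>
  define M where "M = {p \<in> G. \<forall>q\<in>G. q \<subseteq> p \<longrightarrow> q = p}"
  have fin: "finite G"
    using finite_F by (simp add: G_def)
  have below: "\<exists>m\<in>M. m \<subseteq> p" if "p \<in> G" for p
    using finite_has_minimal2[OF fin that] unfolding M_def by blast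
  obtain qs where qs: "set qs = M" "distinct qs"
    using finite_distinct_list[of M] fin by (auto simp: M_def)
  have "incomp_idem_primes R qs"
    unfolding incomp_idem_primes_def
  proof (intro conjI ballI allI impI)
    fix q assume "q \<in> set qs"
    then have "q \<in> F"
      using qs by (auto simp: M_def G_def)
    then show "prime_ideal R q" "idempotent_ideal R q"
      using prime_F idempotent_F by auto
  next
    fix i j assume ij: "i < length qs" "j < length qs" "i \<noteq> j"
    then have "qs ! i \<in> M" "qs ! j \<in> M" "qs ! i \<noteq> qs ! j"
      using qs(1) nth_mem nth_eq_iff_index_eq[OF qs(2)] by auto
    then show "\<not> qs ! i \<subseteq> qs ! j"
      by (auto simp: M_def)
  qed
  moreover have "a = ideal_prod_list R qs"
  proof -
    have "\<Inter>G = \<Inter>M"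
      using below by (auto simp: M_def)
    then have "a = ideal_inter_list R qs"
      using idempotent_eq_inter[OF assms] qs(1) by (simp add: ideal_inter_list_def G_def)
    moreover have "set qs \<subseteq> F"
      using qs by (auto simp: M_def G_def)
    ultimately show ?thesis
      using prod_list_eq_inter_list by simp
  qed
  ultimately show ?thesis
    by (rule that)
qed

end

section \<open>Transfer to \<open>S n\<close>\<close>

lemma same_up_to_permI:
  assumes "distinct qs" "distinct rs" "set qs = set rs"
  shows "same_up_to_perm qs rs"
proof -
  have "mset qs = mset rs"
    using assms by (simp add: set_eq_iff_mset_eq_distinct)
  then obtain p where p: "p permutes {..<length rs}" "permute_list p rs = qs"
    by (rule mset_eq_permutation)
  moreover have len: "length qs = length rs"
    using p(2) by auto
  ultimately show ?thesis
    unfolding same_up_to_perm_def using permute_list_nth[OF p(1)] by metis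
qed

text \<open>Restricted to \<open>bic_alg n\<close>, this is the ring isomorphism onto
  \<open>S n\<close>.\<close>

definition fn_of :: "(bic \<Rightarrow>\<^sub>0 'k::field) \<Rightarrow> mon \<Rightarrow> 'k" where
  "fn_of p = (\<lambda>m. lookup p (Bic (fst m) (snd m)))"

lemma inj_fn_of: "inj fn_of"
proof (rule injI, rule poly_mapping_eqI)
  fix p q :: "bic \<Rightarrow>\<^sub>0 'k::field" and u
  assume "fn_of p = fn_of q"
  from fun_cong[OF this, of "(xe u, ye u)"] show "lookup p u = lookup q u"
    by (simp add: fn_of_def)
qed

lemma fn_of_add: "(\<lambda>m. fn_of p m + fn_of q m) = fn_of (p + q)"
  by (simp add: fn_of_def lookup_add)

lemma fn_of_mult: "S_mult (fn_of p) (fn_of q) = fn_of (p * q)"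
proof
  fix m :: mon
  let ?f = "\<lambda>(u, v). (Bic (fst u) (snd u), Bic (fst v) (snd v)) :: bic \<times> bic"
  let ?g = "\<lambda>(u, v). ((xe u, ye u), (xe v, ye v))"
  let ?w = "Bic (fst m) (snd m)"
  have "p * q = (\<Sum>u\<in>keys p. \<Sum>v\<in>keys q. single (u + v) (lookup p u * lookup q v))"
  proof -
    have "p * q = (\<Sum>u\<in>keys p. single u (lookup p u)) * (\<Sum>v\<in>keys q. single v (lookup q v))"
      by (simp only: sum_single_keys)
    then show ?thesis
      by (simp add: sum_product mult_single)
  qed
  then have "fn_of (p * q) m
      = (\<Sum>u\<in>keys p. \<Sum>v\<in>keys q. if u + v = ?w then lookup p u * lookup q v else 0)"
    by (simp add: fn_of_def lookup_sum lookup_single when_def)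
  also have "\<dots> = (\<Sum>(u, v)\<in>keys p \<times> keys q. if u + v = ?w then lookup p u * lookup q v else 0)"
    by (simp add: sum.cartesian_product)
  also have "\<dots> = (\<Sum>(u, v)\<in>{(u, v). u \<in> keys p \<and> v \<in> keys q \<and> u + v = ?w}. lookup p u * lookup q v)"
    by (rule sum.mono_neutral_cong_right) (auto split: if_splits)
  also have "\<dots> = S_mult (fn_of p) (fn_of q) m"
    unfolding S_mult_def
    by (rule sum.reindex_bij_witness[of _ ?f ?g])
      (auto simp: fn_of_def in_keys_iff mon_mult_def plus_bic_def prod_eq_iff)
  finally show "S_mult (fn_of p) (fn_of q) m = fn_of (p * q) m"
    by simp
qed

lemma fn_of_bic_alg: "fn_of ` bic_alg n = S_carrier n"
proof (intro equalityI subsetI)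
  fix f assume "f \<in> fn_of ` bic_alg n"
  then obtain p where p: "p \<in> bic_alg n" "f = fn_of p"
    by blast
  have key: "Bic (fst m) (snd m) \<in> keys p" if "f m \<noteq> 0" for m
    using that by (simp add: p fn_of_def in_keys_iff)
  have "{m. f m \<noteq> 0} \<subseteq> (\<lambda>u. (xe u, ye u)) ` keys p"
  proof
    fix m assume "m \<in> {m. f m \<noteq> 0}"
    then show "m \<in> (\<lambda>u. (xe u, ye u)) ` keys p"
      by (intro image_eqI[where x = "Bic (fst m) (snd m)"]) (simp_all add: key)
  qed
  then have "finite {m. f m \<noteq> 0}"
    by (rule finite_subset) simp
  moreover have "valid_mon n m" if "f m \<noteq> 0" for m
    using key[OF that] p(1) by (force simp: bic_alg_def valid_mon_def)
  ultimately show "f \<in> S_carrier n"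
    by (simp add: S_carrier_def)
next
  fix f :: "mon \<Rightarrow> 'k::field"
  assume f: "f \<in> S_carrier n"
  define p where "p = Abs_poly_mapping (\<lambda>u. f (xe u, ye u))"
  have "{u. f (xe u, ye u) \<noteq> 0} \<subseteq> (\<lambda>m. Bic (fst m) (snd m)) ` {m. f m \<noteq> 0}"
  proof
    fix u assume "u \<in> {u. f (xe u, ye u) \<noteq> 0}"
    then show "u \<in> (\<lambda>m. Bic (fst m) (snd m)) ` {m. f m \<noteq> 0}"
      by (intro image_eqI[where x = "(xe u, ye u)"]) simp_all
  qed
  then have "finite {u. f (xe u, ye u) \<noteq> 0}"
    using f by (auto simp: S_carrier_def intro: finite_subset)
  then have lookup_p: "lookup p u = f (xe u, ye u)" for u
    by (simp add: p_def)
  have "p \<in> bic_alg n"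
    using f unfolding bic_alg_def S_carrier_def valid_mon_def
    by (auto simp: in_keys_iff lookup_p)
  moreover have "f = fn_of p"
    by (simp add: fn_of_def lookup_p)
  ultimately show "f \<in> fn_of ` bic_alg n"
    by blast
qed

lemma S_simps:
  "carrier (S n) = fn_of ` bic_alg n"
  "fn_of p \<otimes>\<^bsub>S n\<^esub> fn_of q = fn_of (p * q)"
  "fn_of p \<oplus>\<^bsub>S n\<^esub> fn_of q = fn_of (p + q)"
  "\<one>\<^bsub>S n\<^esub> = fn_of 1"
  "\<zero>\<^bsub>S n\<^esub> = fn_of 0"
proof -
  have "Bic (fst m) (snd m) = 0 \<longleftrightarrow> m = mon_one" for m
    by (auto simp: zero_bic_def mon_one_def prod_eq_iff)
  then show "\<one>\<^bsub>S n\<^esub> = fn_of 1"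
    by (auto simp: S_def fn_of_def lookup_one when_def)
qed (simp_all add: S_def fn_of_bic_alg fn_of_mult fn_of_add, simp add: fn_of_def)

lemma ring_S: "ring (S n)"
proof (rule ringI)
  show "abelian_group (S n)"
  proof (rule abelian_groupI)
    fix x assume "x \<in> carrier (S n)"
    then obtain p where "p \<in> bic_alg n" "x = fn_of p"
      by (auto simp: S_simps)
    then show "\<exists>y\<in>carrier (S n). y \<oplus>\<^bsub>S n\<^esub> x = \<zero>\<^bsub>S n\<^esub>"
      by (intro bexI[of _ "fn_of (- p)"]) (auto simp: S_simps)
  qed (auto simp: S_simps ac_simps)
  show "Group.monoid (S n)"
    by (rule monoidI) (auto simp: S_simps mult.assoc)
qed (auto simp: S_simps distrib_left distrib_right)

lemma ideal_imp_two_sided: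
  assumes "ideal I (S n)"
  shows "two_sided n {p \<in> bic_alg n. fn_of p \<in> I}"
proof -
  interpret ideal I "S n" by fact
  have "fn_of 0 \<in> I"
    using additive_subgroup.zero_closed[OF is_additive_subgroup] by (simp add: S_simps)
  moreover have "fn_of (p + q) \<in> I" if "fn_of p \<in> I" "fn_of q \<in> I" for p q
    using additive_subgroup.a_closed[OF is_additive_subgroup that] by (simp add: S_simps)
  moreover have "fn_of (r * p) \<in> I" "fn_of (p * r) \<in> I" if "fn_of p \<in> I" "r \<in> bic_alg n" for p r
    using I_l_closed[OF that(1), of "fn_of r"] I_r_closed[OF that(1), of "fn_of r"] that(2)
    by (auto simp: S_simps)
  ultimately show ?thesis
    by (auto simp: two_sided_def additive_closed_def)
qed

lemma two_sided_imp_ideal: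
  assumes A: "two_sided n A"
  shows "ideal (fn_of ` A) (S n)"
proof -
  interpret ring "S n" by (rule ring_S)
  note D = two_sidedD[OF A]
  show ?thesis
  proof (rule idealI[OF ring_S])
    show "subgroup (fn_of ` A) (add_monoid (S n))"
    proof (rule add.subgroupI)
      fix x assume "x \<in> fn_of ` A"
      then obtain p where p: "p \<in> A" "x = fn_of p"
        by blast
      have "- p \<in> A"
        using two_sided_diff[OF A D(2) p(1)] by simp
      moreover have "\<ominus>\<^bsub>S n\<^esub> x = fn_of (- p)"
        using p D(1) by (intro minus_equality) (auto simp: S_simps)
      ultimately show "\<ominus>\<^bsub>S n\<^esub> x \<in> fn_of ` A"
        by blast
    qed (use D in \<open>auto simp: S_simps\<close>)
  qed (use D in \<open>auto simp: S_simps\<close>)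
qed

lemma fn_of_in_image_iff [simp]: "fn_of p \<in> fn_of ` A \<longleftrightarrow> p \<in> A"
  by (rule inj_image_mem_iff[OF inj_fn_of])

lemma fn_of_pullback:
  assumes "ideal I (S n)"
  shows "fn_of ` {p \<in> bic_alg n. fn_of p \<in> I} = I"
proof -
  interpret ideal I "S n" by fact
  show ?thesis
    using Icarr by (force simp: S_simps)
qed

text \<open>If x and y witness that neither ideal is contained, then x h still lies in the first
  ideal, so x h y lies in the product of the ideals for every h.\<close>

lemma prime_ideal_std_prime:
  assumes J: "J \<subseteq> {..<n}"
  shows "prime_ideal (S n) (fn_of ` std_prime n J :: (mon \<Rightarrow> 'k::field) set)"
  unfolding prime_ideal_def
proof (intro conjI allI impI)
  let ?P = "fn_of ` std_prime n J :: (mon \<Rightarrow> 'k) set"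
  show "ideal ?P (S n)"
    by (rule two_sided_imp_ideal[OF two_sided_std_prime[OF J]])
  show "?P \<noteq> carrier (S n)"
    using one_notin_std_prime bic_alg_one by (metis S_simps(1) fn_of_in_image_iff)
  fix I I' :: "(mon \<Rightarrow> 'k) set"
  assume I: "ideal I (S n)" "ideal I' (S n)" and prod: "ideal_prod (S n) I I' \<subseteq> ?P"
  show "I \<subseteq> ?P \<or> I' \<subseteq> ?P"
  proof (rule ccontr)
    assume "\<not> ?thesis"
    then obtain x y where xy: "x \<in> I" "x \<notin> ?P" "y \<in> I'" "y \<notin> ?P"
      by blast
    obtain f where f: "f \<in> bic_alg n" "x = fn_of f"
      using xy(1) fn_of_pullback[OF I(1)] by blast
    obtain g where g: "g \<in> bic_alg n" "y = fn_of g"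
      using xy(3) fn_of_pullback[OF I(2)] by blast
    obtain h where h: "h \<in> bic_alg n" "f * h * g \<notin> std_prime n J"
      using std_prime_is_prime[OF J f(1) _ g(1)] xy f g by auto
    have "x \<otimes>\<^bsub>S n\<^esub> fn_of h \<in> I"
      using ideal.I_r_closed[OF I(1) xy(1)] h(1) by (simp add: S_simps)
    then have "x \<otimes>\<^bsub>S n\<^esub> fn_of h \<otimes>\<^bsub>S n\<^esub> y \<in> ?P"
      using prod ideal_prod.prod[OF _ xy(3), of _ I "S n"] by blast
    then show False
      using h(2) by (simp add: f g S_simps)
  qed
qed

lemma std_prime_inter_subset_prod:
  assumes J: "J \<subseteq> {..<n}"
  shows "fn_of ` std_prime n J \<inter> Q \<subseteq> ideal_prod (S n) (fn_of ` std_prime n J) Q"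
proof
  fix x assume x: "x \<in> fn_of ` std_prime n J \<inter> Q"
  then obtain p where p: "p \<in> std_prime n J" "x = fn_of p"
    by blast
  obtain N where "std_unit J N * p = p"
    using std_prime_left_unit[OF p(1)] .
  then have "x = fn_of (std_unit J N) \<otimes>\<^bsub>S n\<^esub> x"
    by (simp add: p S_simps)
  then show "x \<in> ideal_prod (S n) (fn_of ` std_prime n J) Q"
    using x ideal_prod.prod[of "fn_of (std_unit J N)" "fn_of ` std_prime n J" x Q "S n"]
      std_unit_in_std_prime[OF J] by auto
qed

text \<open>\<open>ideal_prod\<close> is built inductively from products and sums, the two
  operations demanded of \<open>X\<close>.\<close>

lemma idempotent_ideal_mult_generated:
  assumes "idempotent_ideal (S n) a"
  shows "mult_generated {p \<in> bic_alg n. fn_of p \<in> a}"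
  unfolding mult_generated_def
proof (intro allI impI)
  let ?A = "{p \<in> bic_alg n. fn_of p \<in> a}"
  fix X assume "additive_closed X \<and> (\<forall>g\<in>?A. \<forall>h\<in>?A. g * h \<in> X)"
  then have X: "additive_closed X" "\<And>g h. g \<in> ?A \<Longrightarrow> h \<in> ?A \<Longrightarrow> g * h \<in> X"
    by blast+
  have a: "ideal a (S n)" "ideal_prod (S n) a a = a"
    using assms by (auto simp: idempotent_ideal_def)
  have "x \<in> fn_of ` X" if "x \<in> ideal_prod (S n) a a" for x
    using that
  proof induction
    case (prod i j)
    then obtain p q where "p \<in> ?A" "i = fn_of p" "q \<in> ?A" "j = fn_of q"
      using fn_of_pullback[OF a(1)] by (metis (no_types, lifting) imageE)
    then show ?case
      using X(2) by (simp add: S_simps)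
  next
    case (sum s1 s2)
    then show ?case
      using X(1) by (auto simp: S_simps additive_closed_def)
  qed
  then have "p \<in> X" if "fn_of p \<in> a" for p
    using that a(2) by (metis fn_of_in_image_iff)
  then show "?A \<subseteq> X"
    by blast
qed

lemma prime_separated_ring_S:
  "prime_separated_ring (S n) ((\<lambda>J. fn_of ` std_prime n J :: (mon \<Rightarrow> 'k::field) set) ` Pow {..<n})"
proof (rule prime_separated_ring.intro[OF ring_S prime_separated_ring_axioms.intro])
  let ?F = "(\<lambda>J. fn_of ` std_prime n J :: (mon \<Rightarrow> 'k) set) ` Pow {..<n}"
  show "finite ?F"
    by simp
  show "prime_ideal (S n) p" if "p \<in> ?F" for p
    using that prime_ideal_std_prime by blast
  show "p \<inter> Q \<subseteq> ideal_prod (S n) p Q" if "p \<in> ?F" for p Q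
    using that std_prime_inter_subset_prod by blast
  fix a :: "(mon \<Rightarrow> 'k) set" and x
  assume a: "idempotent_ideal (S n) a" and x: "x \<in> carrier (S n)" "x \<notin> a"
  let ?A = "{p \<in> bic_alg n. fn_of p \<in> a}"
  have ideal: "ideal a (S n)"
    using a by (simp add: idempotent_ideal_def)
  note A = ideal_imp_two_sided[OF ideal]
  have gr: "graded n ?A"
    unfolding graded_def using part_in_idempotent[OF A idempotent_ideal_mult_generated[OF a]] by blast
  obtain f where f: "f \<in> bic_alg n" "x = fn_of f"
    using x(1) by (auto simp: S_simps)
  then have "f \<notin> ?A"
    using x(2) by simp
  then obtain J where J: "J \<subseteq> {..<n}" "?A \<subseteq> std_prime n J" "f \<notin> std_prime n J"
    by (rule graded_ideal_separation[OF A gr f(1)])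
  have "a \<subseteq> fn_of ` std_prime n J"
    using J(2) fn_of_pullback[OF ideal] by blast
  moreover have "x \<notin> fn_of ` std_prime n J"
    using J(3) f(2) by simp
  ultimately show "\<exists>p\<in>?F. a \<subseteq> p \<and> x \<notin> p"
    using J(1) by blast
qed

theorem theorem7p3:
  fixes n :: nat and a :: "(mon \<Rightarrow> 'k::field) set"
  assumes "idempotent_ideal (S n) a"
      and "a \<noteq> carrier (S n)"
  shows
    \<comment> \<open>(1) existence and uniqueness of the product decomposition\<close>
    "(\<exists>qs. incomp_idem_primes (S n) qs \<and> a = ideal_prod_list (S n) qs) \<and>
     (\<forall>qs rs. incomp_idem_primes (S n) qs \<and> a = ideal_prod_list (S n) qs \<and>
              incomp_idem_primes (S n) rs \<and> a = ideal_prod_list (S n) rs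
              \<longrightarrow> same_up_to_perm qs rs) \<and>
     \<comment> \<open>(2) existence and uniqueness of the intersection decomposition\<close>
     (\<exists>qs. incomp_idem_primes (S n) qs \<and> a = ideal_inter_list (S n) qs) \<and>
     (\<forall>qs rs. incomp_idem_primes (S n) qs \<and> a = ideal_inter_list (S n) qs \<and>
              incomp_idem_primes (S n) rs \<and> a = ideal_inter_list (S n) rs
              \<longrightarrow> same_up_to_perm qs rs) \<and>
     \<comment> \<open>(3) the two sets of primes coincide\<close>
     (\<forall>qs rs. incomp_idem_primes (S n) qs \<and> a = ideal_prod_list (S n) qs \<and>
              incomp_idem_primes (S n) rs \<and> a = ideal_inter_list (S n) rs
              \<longrightarrow> set qs = set rs) \<and>
     \<comment> \<open>(4) they form Min(a); hence a is the product and the intersection of Min(a),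
         and every minimal prime over a is idempotent\<close>
     (\<forall>qs. incomp_idem_primes (S n) qs \<and> a = ideal_prod_list (S n) qs
              \<longrightarrow> set qs = min_primes (S n) a) \<and>
     finite (min_primes (S n) a) \<and>
     (\<forall>ps. distinct ps \<and> set ps = min_primes (S n) a \<longrightarrow> a = ideal_prod_list (S n) ps) \<and>
     a = carrier (S n) \<inter> \<Inter>(min_primes (S n) a) \<and>
     (\<forall>p \<in> min_primes (S n) a. idempotent_ideal (S n) p)"
proof -
  interpret prime_separated_ring "S n"
    "(\<lambda>J. fn_of ` std_prime n J :: (mon \<Rightarrow> 'k) set) ` Pow {..<n}"
    by (rule prime_separated_ring_S)
  let ?M = "min_primes (S n) a"
  obtain qs where qs: "incomp_idem_primes (S n) qs" "a = ideal_prod_list (S n) qs"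
    by (rule ex_decomposition[OF assms(1)])
  \<comment> \<open>All admissible factors belong to the separating family, where products are
    intersections; this carries the product results over to intersections.\<close>
  have inter_iff: "ideal_inter_list (S n) rs = ideal_prod_list (S n) rs"
    if "incomp_idem_primes (S n) rs" for rs :: "(mon \<Rightarrow> 'k) set list"
    using prod_list_eq_inter_list[OF incomp_idem_primes_subset[OF that]] by simp
  have M: "set rs = ?M" if "incomp_idem_primes (S n) rs \<and> a = ideal_prod_list (S n) rs" for rs
    using set_eq_min_primes that by blast
  \<comment> \<open>Both lists enumerate the minimal primes without repetition.\<close>
  have perm: "same_up_to_perm rs ts"
    if "incomp_idem_primes (S n) rs \<and> a = ideal_prod_list (S n) rs"
      "incomp_idem_primes (S n) ts \<and> a = ideal_prod_list (S n) ts" for rs ts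
    using that M[OF that(1)] M[OF that(2)] incomp_idem_primesD(2) by (intro same_up_to_permI) auto
  have F: "?M \<subseteq> (\<lambda>J. fn_of ` std_prime n J) ` Pow {..<n}"
    using M[of qs] qs incomp_idem_primes_subset by blast
  have inter: "a = carrier (S n) \<inter> \<Inter>?M"
    using inter_iff[OF qs(1)] qs(2) M[of qs] qs(1) by (simp add: ideal_inter_list_def)
  show ?thesis
  proof (intro conjI allI impI ballI)
    show "\<exists>qs. incomp_idem_primes (S n) qs \<and> a = ideal_prod_list (S n) qs"
      using qs by (intro exI conjI)
    show "\<exists>qs. incomp_idem_primes (S n) qs \<and> a = ideal_inter_list (S n) qs"
      using qs inter_iff by metis
    show "a = carrier (S n) \<inter> \<Inter>?M"
      by (rule inter)
    show "finite ?M"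
      using F finite_F by (rule finite_subset)
    show "idempotent_ideal (S n) p" if "p \<in> ?M" for p
      using idempotent_F F that by blast
    show "a = ideal_prod_list (S n) ps" if "distinct ps \<and> set ps = ?M" for ps
      using prod_list_eq_inter_list[of ps] F that inter by (simp add: ideal_inter_list_def)
    fix rs ts
    show "set rs = ?M" if "incomp_idem_primes (S n) rs \<and> a = ideal_prod_list (S n) rs"
      by (rule M[OF that])
    show "same_up_to_perm rs ts"
      if "incomp_idem_primes (S n) rs \<and> a = ideal_prod_list (S n) rs \<and>
        incomp_idem_primes (S n) ts \<and> a = ideal_prod_list (S n) ts"
      using perm[of rs ts] that by blast
    show "same_up_to_perm rs ts"
      if "incomp_idem_primes (S n) rs \<and> a = ideal_inter_list (S n) rs \<and>
        incomp_idem_primes (S n) ts \<and> a = ideal_inter_list (S n) ts"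
      using perm[of rs ts] that inter_iff by auto
    show "set rs = set ts"
      if "incomp_idem_primes (S n) rs \<and> a = ideal_prod_list (S n) rs \<and>
        incomp_idem_primes (S n) ts \<and> a = ideal_inter_list (S n) ts"
      using M[of rs] M[of ts] that inter_iff by auto
  qed
qed

end
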